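(* In $\mathbb{R}^2$, let $$u_1=(1,0),\qquad u_2=\left(-\tfrac12,\tfrac{\sqrt3}{2}\right),\qquad u_3=(-1,0),\qquad u_4=\left(-\tfrac12,-\tfrac{\sqrt3}{2}\right).$$ Then $$\operatorname{pos}\{u_1,u_2,u_3,u_4\}=\mathbb{R}^2,$$ but there is no convex body $P\subset\mathbb{R}^2$ containing the origin in its interior such that $$S_{-2}(P,\cdot)=\sum_{i=1}^4\delta_{u_i}.$$
   Context: $\operatorname{pos}\{u_1,\ldots,u_N\}=\{\sum_{i}\lambda_iu_i:\lambda_i\ge0\}$ is the positive hull, and $\delta_u$ is the Dirac measure at $u$ on the unit circle $S^1$. A convex body in $\mathbb{R}^2$ is a compact convex set with nonempty interior. For a convex body $K\subset\mathbb{R}^2$ containing the origin in its interior, $h_K(u)=\max_{x\in K}\langle x,u\rangle$ is its support function, $S_K$ is its surface area measure on $S^1$, i.e. $S_K(\omega)=\mathcal{H}^{1}(\nu_K^{-1}(\omega))$ with $\nu_K$ the $\mathcal{H}^{1}$-a.e. defined outer unit normal map on $\partial K$, and for $p\in\mathbb{R}$ the $L_p$ surface area measure is $dS_p(K,\cdot)=h_K^{1-p}\,dS_K$; in particular $dS_{-2}(K,\cdot)=h_K^{3}\,dS_K$. *)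

theory Defs
  imports "HOL-Probability.Probability"
begin

section \<open>Positive hulls and convex bodies\<close>

definition pos_hull :: "'i set \<Rightarrow> ('i \<Rightarrow> 'a::real_vector) \<Rightarrow> 'a set" where
  "pos_hull I u = {\<Sum>i\<in>I. l i *\<^sub>R u i | l. \<forall>i\<in>I. (0::real) \<le> l i}"

definition convex_body :: "'a::euclidean_space set \<Rightarrow> bool" where
  "convex_body K \<longleftrightarrow> compact K \<and> convex K \<and> interior K \<noteq> {}"

text \<open>For nonempty compact \<open>K\<close> the supremum is attained, so it is the maximum.\<close>

definition support_fun :: "'a::euclidean_space set \<Rightarrow> 'a \<Rightarrow> real" where
  "support_fun K u = (SUP x\<in>K. x \<bullet> u)"


section \<open>One-dimensional Hausdorff measure\<close>

text \<open>The boundedness condition is needed because \<^const>\<open>diameter\<close> is a real number, with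
  an unspecified value on unbounded sets. The normalisation is the usual one, under which a
  segment has its length as its measure.\<close>

definition hausdorff1_pre :: "real \<Rightarrow> 'a::metric_space set \<Rightarrow> ennreal" where
  "hausdorff1_pre \<delta> A =
     (INF C\<in>{C :: nat \<Rightarrow> 'a set. A \<subseteq> (\<Union>i. C i) \<and> (\<forall>i. bounded (C i) \<and> diameter (C i) \<le> \<delta>)}.
        \<Sum>i. ennreal (diameter (C i)))"

definition hausdorff1 :: "'a::metric_space set \<Rightarrow> ennreal" where
  "hausdorff1 A = (SUP \<delta>\<in>{0<..}. hausdorff1_pre \<delta> A)"


section \<open>Surface area measures in the plane\<close>

definition outer_unit_normal :: "'a::euclidean_space set \<Rightarrow> 'a \<Rightarrow> 'a \<Rightarrow> bool" where
  "outer_unit_normal K x u \<longleftrightarrow> norm u = 1 \<and> (\<forall>y\<in>K. y \<bullet> u \<le> x \<bullet> u)"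

text \<open>The domain of the outer unit normal map \<open>\<nu>\<^sub>K\<close>; it is all of the boundary except for a
  countable set of points when \<open>K\<close> is a planar convex body.\<close>

definition regular_bdry :: "'a::euclidean_space set \<Rightarrow> 'a set" where
  "regular_bdry K = {x \<in> frontier K. \<exists>!u. outer_unit_normal K x u}"

definition normal_map :: "'a::euclidean_space set \<Rightarrow> 'a \<Rightarrow> 'a" where
  "normal_map K x = (THE u. outer_unit_normal K x u)"

abbreviation circle_borel :: "(real^2) measure" where
  "circle_borel \<equiv> restrict_space borel (sphere 0 1)"

definition surface_area_measure :: "(real^2) set \<Rightarrow> (real^2) measure" where
  "surface_area_measure K = measure_of (sphere 0 1) (sets circle_borel)
     (\<lambda>\<omega>. hausdorff1 {x \<in> regular_bdry K. normal_map K x \<in> \<omega>})"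

definition Lp_surface_area_measure :: "real \<Rightarrow> (real^2) set \<Rightarrow> (real^2) measure" where
  "Lp_surface_area_measure p K =
     density (surface_area_measure K) (\<lambda>u. ennreal (support_fun K u powr (1 - p)))"


section \<open>Well-definedness of the surface area measures\<close>

text \<open>\<^const>\<open>measure_of\<close> yields the null measure when its set function is not countably
  additive. The lemmas below exclude this for \<^const>\<open>surface_area_measure\<close>: the set function
  \<^const>\<open>hausdorff1\<close> is countably additive on Borel sets, as a metric outer measure, and the
  normal map is Borel measurable.\<close>

definition capped_diameter :: "real \<Rightarrow> 'a::metric_space set \<Rightarrow> ennreal" where
  "capped_diameter \<delta> S = (if bounded S \<and> diameter S \<le> \<delta> then ennreal (diameter S) else \<infinity>)"

lemma capped_diameter_increasing: "increasing UNIV (capped_diameter \<delta>)"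
  unfolding increasing_def capped_diameter_def
  by (auto intro!: ennreal_leI diameter_subset dest: bounded_subset)
     (meson bounded_subset diameter_subset order_trans)

lemma capped_diameter_positive: "0 < \<delta> \<Longrightarrow> positive UNIV (capped_diameter \<delta>)"
  by (auto simp: positive_def capped_diameter_def)

lemma ring_UNIV: "ring_of_sets UNIV (UNIV :: 'a set set)"
  by (metis Pow_UNIV algebra.axioms(1) algebra_Pow)

lemma hausdorff1_pre_eq_outer_measure:
  fixes A :: "'a::metric_space set"
  assumes "0 < \<delta>"
  shows "hausdorff1_pre \<delta> A = outer_measure UNIV (capped_diameter \<delta>) A"
proof (rule antisym)
  show "outer_measure UNIV (capped_diameter \<delta>) A \<le> hausdorff1_pre \<delta> A"
    unfolding hausdorff1_pre_def
  proof (rule INF_greatest, clarify)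
    fix C :: "nat \<Rightarrow> 'a set"
    assume C: "A \<subseteq> (\<Union>i. C i)" "\<forall>i. bounded (C i) \<and> diameter (C i) \<le> \<delta>"
    have "outer_measure UNIV (capped_diameter \<delta>) A \<le> (\<Sum>i. capped_diameter \<delta> (C i))"
      by (rule ring_of_sets.outer_measure_le[OF ring_UNIV capped_diameter_positive[OF assms]
            capped_diameter_increasing]) (use C in auto)
    also have "\<dots> = (\<Sum>i. ennreal (diameter (C i)))"
      using C by (simp add: capped_diameter_def)
    finally show "outer_measure UNIV (capped_diameter \<delta>) A \<le> (\<Sum>i. ennreal (diameter (C i)))" .
  qed
  show "hausdorff1_pre \<delta> A \<le> outer_measure UNIV (capped_diameter \<delta>) A"
    unfolding outer_measure_def
  proof (rule INF_greatest, clarify)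
    fix C :: "nat \<Rightarrow> 'a set"
    assume C: "A \<subseteq> (\<Union>i. C i)"
    show "hausdorff1_pre \<delta> A \<le> (\<Sum>i. capped_diameter \<delta> (C i))"
    proof (cases "\<forall>i. bounded (C i) \<and> diameter (C i) \<le> \<delta>")
      case True
      then show ?thesis
        unfolding hausdorff1_pre_def
        by (intro INF_lower2[of C]) (use C in \<open>auto simp: capped_diameter_def\<close>)
    next
      case False
      then obtain i where "\<not> (bounded (C i) \<and> diameter (C i) \<le> \<delta>)" by blast
      then have "capped_diameter \<delta> (C i) = \<infinity>" by (simp only: capped_diameter_def if_False)
      then have "(\<Sum>i. capped_diameter \<delta> (C i)) = \<infinity>"
        by (metis ennreal_suminf_lessD infinity_ennreal_def less_top less_irrefl)
      then show ?thesis by simp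
    qed
  qed
qed

lemma hausdorff1_pre_mono: "A \<subseteq> B \<Longrightarrow> hausdorff1_pre \<delta> A \<le> hausdorff1_pre \<delta> B"
  unfolding hausdorff1_pre_def by (intro INF_superset_mono) auto

lemma hausdorff1_pre_antimono: "\<delta> \<le> \<epsilon> \<Longrightarrow> hausdorff1_pre \<epsilon> A \<le> hausdorff1_pre \<delta> A"
  unfolding hausdorff1_pre_def by (intro INF_superset_mono) (auto intro: order_trans)

lemma hausdorff1_pre_le: "0 < \<delta> \<Longrightarrow> hausdorff1_pre \<delta> A \<le> hausdorff1 A"
  unfolding hausdorff1_def by (rule SUP_upper) auto

lemma hausdorff1_mono: "A \<subseteq> B \<Longrightarrow> hausdorff1 A \<le> hausdorff1 B"
  unfolding hausdorff1_def by (intro SUP_mono) (auto intro: hausdorff1_pre_mono)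

lemma hausdorff1_empty [simp]: "hausdorff1 {} = 0"
proof -
  have "hausdorff1_pre \<delta> ({} :: 'a set) = 0" if "0 < \<delta>" for \<delta>
    unfolding hausdorff1_pre_eq_outer_measure[OF that]
    by (rule outer_measure_empty[OF capped_diameter_positive[OF that]]) simp
  then have "hausdorff1 ({} :: 'a set) = (SUP \<delta>\<in>{0::real<..}. 0)"
    unfolding hausdorff1_def by (intro SUP_cong) auto
  also have "\<dots> = 0" by (simp add: bot_ennreal)
  finally show ?thesis .
qed

lemma hausdorff1_subadditive:
  fixes A :: "nat \<Rightarrow> 'a::metric_space set"
  shows "hausdorff1 (\<Union>i. A i) \<le> (\<Sum>i. hausdorff1 (A i))"
  unfolding hausdorff1_def[of "\<Union>i. A i"]
proof (rule SUP_least)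
  fix \<delta> :: real assume "\<delta> \<in> {0<..}"
  then have \<delta>: "0 < \<delta>" by simp
  let ?O = "outer_measure UNIV (capped_diameter \<delta>) :: 'a set \<Rightarrow> _"
  have sub: "countably_subadditive (Pow UNIV) ?O"
    by (rule ring_of_sets.countably_subadditive_outer_measure[OF ring_UNIV
          capped_diameter_positive[OF \<delta>] capped_diameter_increasing])
  have "hausdorff1_pre \<delta> (\<Union>i. A i) \<le> (\<Sum>i. hausdorff1_pre \<delta> (A i))"
  proof -
    define D where "D = disjointed A"
    have D: "(\<Union>i. D i) = (\<Union>i. A i)" "disjoint_family D" "\<And>i. D i \<subseteq> A i"
      unfolding D_def by (auto simp: UN_disjointed_eq disjoint_family_disjointed dest: subsetD[OF disjointed_subset])
    have "?O (\<Union>i. D i) \<le> (\<Sum>i. ?O (D i))"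
      using sub D(2)
      unfolding countably_subadditive_def by auto
    also have "\<dots> \<le> (\<Sum>i. ?O (A i))"
      using hausdorff1_pre_mono[OF D(3), of \<delta>]
      by (intro suminf_le) (auto simp: hausdorff1_pre_eq_outer_measure[OF \<delta>])
    finally show ?thesis
      by (simp add: D(1) hausdorff1_pre_eq_outer_measure[OF \<delta>])
  qed
  also have "\<dots> \<le> (\<Sum>i. hausdorff1 (A i))"
    by (intro suminf_le hausdorff1_pre_le \<delta>) auto
  finally show "hausdorff1_pre \<delta> (\<Union>i. A i) \<le> (\<Sum>i. hausdorff1 (A i))" .
qed

lemma hausdorff1_Un_le:
  fixes A B :: "'a::metric_space set"
  shows "hausdorff1 (A \<union> B) \<le> hausdorff1 A + hausdorff1 B"
proof -
  have "hausdorff1 (A \<union> B) = hausdorff1 (\<Union>i. binaryset A B i)"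
    by (simp add: UN_binaryset_eq)
  also have "\<dots> \<le> (\<Sum>i. hausdorff1 (binaryset A B i))"
    by (rule hausdorff1_subadditive)
  also have "\<dots> = hausdorff1 A + hausdorff1 B"
    by (rule suminf_binaryset_eq) simp
  finally show ?thesis .
qed

lemma hausdorff1_outer_measure_space: "outer_measure_space UNIV hausdorff1"
  by (auto simp: outer_measure_space_def positive_def increasing_def countably_subadditive_def
      intro: hausdorff1_mono hausdorff1_subadditive)

lemma hausdorff1_metric:
  fixes A B :: "'a::metric_space set"
  assumes d: "0 < d" "\<And>a b. a \<in> A \<Longrightarrow> b \<in> B \<Longrightarrow> d \<le> dist a b"
  shows "hausdorff1 A + hausdorff1 B \<le> hausdorff1 (A \<union> B)"
proof -
  have *: "hausdorff1_pre \<delta> A + hausdorff1_pre \<delta> B \<le> hausdorff1 (A \<union> B)" if \<delta>: "0 < \<delta>" for \<delta>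
  proof -
    define \<epsilon> where "\<epsilon> = min \<delta> (d / 2)"
    have \<epsilon>: "0 < \<epsilon>" "\<epsilon> \<le> \<delta>" "\<epsilon> < d" using \<delta> d(1) by (auto simp: \<epsilon>_def)
    have "hausdorff1_pre \<delta> A + hausdorff1_pre \<delta> B \<le> hausdorff1_pre \<epsilon> (A \<union> B)"
      unfolding hausdorff1_pre_def[of _ "A \<union> B"]
    proof (rule INF_greatest, clarify)
      fix C :: "nat \<Rightarrow> 'a set"
      assume C: "A \<union> B \<subseteq> (\<Union>i. C i)" and C': "\<forall>i. bounded (C i) \<and> diameter (C i) \<le> \<epsilon>"
      define P where "P S = (\<lambda>i. if C i \<inter> S = {} then {} else C i)" for S
      have P: "hausdorff1_pre \<delta> S \<le> (\<Sum>i. ennreal (diameter (P S i)))" if "S \<subseteq> A \<union> B" for S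
      proof -
        have "\<exists>i. x \<in> P S i" if "x \<in> S" for x
          using that C \<open>S \<subseteq> A \<union> B\<close> by (auto simp: P_def) blast
        then have "S \<subseteq> (\<Union>i. P S i)" by auto
        moreover have "bounded (P S i) \<and> diameter (P S i) \<le> \<delta>" for i
          using C' \<epsilon> \<delta> by (auto simp: P_def intro: order_trans)
        ultimately show ?thesis
          unfolding hausdorff1_pre_def by (intro INF_lower) auto
      qed
      have disj: "C i \<inter> A = {} \<or> C i \<inter> B = {}" for i
      proof (rule ccontr)
        assume "\<not> ?thesis"
        then obtain a b where "a \<in> C i" "a \<in> A" "b \<in> C i" "b \<in> B" by auto
        then show False
          using d(2)[of a b] diameter_bounded_bound[of "C i" a b] C'[rule_format, of i] \<epsilon>(3) by linarith
      qed
      have "hausdorff1_pre \<delta> A + hausdorff1_pre \<delta> B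
          \<le> (\<Sum>i. ennreal (diameter (P A i))) + (\<Sum>i. ennreal (diameter (P B i)))"
        by (intro add_mono P) auto
      also have "\<dots> = (\<Sum>i. ennreal (diameter (P A i)) + ennreal (diameter (P B i)))"
        by (rule suminf_add) auto
      also have "\<dots> \<le> (\<Sum>i. ennreal (diameter (C i)))"
        by (rule suminf_le) (use disj in \<open>auto simp: P_def\<close>)
      finally show "hausdorff1_pre \<delta> A + hausdorff1_pre \<delta> B \<le> (\<Sum>i. ennreal (diameter (C i)))" .
    qed
    also have "\<dots> \<le> hausdorff1 (A \<union> B)" by (rule hausdorff1_pre_le[OF \<epsilon>(1)])
    finally show ?thesis .
  qed
  have "hausdorff1 A + hausdorff1 B = (SUP \<delta>\<in>{0<..}. hausdorff1_pre \<delta> A + hausdorff1_pre \<delta> B)"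
    unfolding hausdorff1_def
  proof (rule SUP_add_directed_ennreal[symmetric])
    fix i j :: real assume "i \<in> {0<..}" "j \<in> {0<..}"
    then show "\<exists>k\<in>{0<..}. hausdorff1_pre i A + hausdorff1_pre j B
        \<le> hausdorff1_pre k A + hausdorff1_pre k B"
      by (intro bexI[of _ "min i j"] add_mono hausdorff1_pre_antimono) auto
  qed
  also have "\<dots> \<le> hausdorff1 (A \<union> B)"
    by (rule SUP_least) (use * in auto)
  finally show ?thesis .
qed

lemma hausdorff1_separated_sum:
  fixes R :: "nat \<Rightarrow> 'a::metric_space set"
  assumes sep: "\<And>i j. i < j \<Longrightarrow> \<exists>d>0. \<forall>a\<in>R i. \<forall>b\<in>(\<Union>k\<in>{j..}. R k). d \<le> dist a b"
  shows "(\<Sum>i. hausdorff1 (R i)) \<le> hausdorff1 (\<Union>i. R i)"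
proof -
  have "(\<Sum>i<n. hausdorff1 (R (m + i))) \<le> hausdorff1 (\<Union>k\<in>{m..<m+n}. R k)" for m n
  proof (induction n arbitrary: m)
    case (Suc n)
    obtain d where d: "0 < d" "\<forall>a\<in>R m. \<forall>b\<in>(\<Union>k\<in>{Suc m..}. R k). d \<le> dist a b"
      using sep[of m "Suc m"] by auto
    have "(\<Sum>i<Suc n. hausdorff1 (R (m + i)))
        = hausdorff1 (R m) + (\<Sum>i<n. hausdorff1 (R (Suc m + i)))"
      by (simp add: sum.lessThan_Suc_shift del: sum.lessThan_Suc)
    also have "\<dots> \<le> hausdorff1 (R m) + hausdorff1 (\<Union>k\<in>{Suc m..<Suc m+n}. R k)"
      by (intro add_left_mono Suc.IH)
    also have "\<dots> \<le> hausdorff1 (R m \<union> (\<Union>k\<in>{Suc m..<Suc m+n}. R k))"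
      by (rule hausdorff1_metric[OF d(1)]) (use d(2) in auto)
    also have "R m \<union> (\<Union>k\<in>{Suc m..<Suc m+n}. R k) = (\<Union>k\<in>{m..<m+Suc n}. R k)"
    proof -
      have "{m..<m + Suc n} = insert m {Suc m..<Suc m + n}" by auto
      then show ?thesis by simp
    qed
    finally show ?case .
  qed simp
  from this[where m = 0] have "(\<Sum>i<n. hausdorff1 (R i)) \<le> hausdorff1 (\<Union>i. R i)" for n
    by (auto intro: order_trans[OF _ hausdorff1_mono] simp: lessThan_atLeast0)
  then show ?thesis
    by (intro suminf_le_const) auto
qed

lemma hausdorff1_closed_in_lambda_system:
  fixes F :: "'a::metric_space set"
  assumes "closed F"
  shows "F \<in> lambda_system UNIV UNIV hausdorff1"
proof (cases "F = {}")
  case True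
  then show ?thesis by (simp add: lambda_system_def)
next
  case ne: False
  have le: "hausdorff1 (F \<inter> A) + hausdorff1 (A - F) \<le> hausdorff1 A" for A :: "'a set"
  proof (cases "hausdorff1 A = \<infinity>")
    case fin: False
    define r where "r n = 1 / (real n + 1)" for n
    have r_pos: "0 < r n" for n by (simp add: r_def)
    have r_anti: "r n < r m" if "m < n" for m n
      using that by (simp add: r_def field_simps)
    define S where "S n = {x \<in> A. r n \<le> infdist x F}" for n
    define R where "R n = {x \<in> A. r (Suc n) \<le> infdist x F \<and> infdist x F < r n}" for n
    have far: "\<exists>d>0. \<forall>a\<in>R i. \<forall>b\<in>(\<Union>k\<in>{j..}. R k). d \<le> dist a b" if ij: "Suc i < j" for i j
    proof (intro exI[of _ "r (Suc i) - r j"] conjI ballI)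
      show "0 < r (Suc i) - r j" using r_anti[OF ij] by simp
      fix a b assume a: "a \<in> R i" and "b \<in> (\<Union>k\<in>{j..}. R k)"
      then obtain k where k: "j \<le> k" "b \<in> R k" by auto
      then have "infdist b F < r j"
        using r_anti[of j k] by (cases "j = k") (auto simp: R_def)
      moreover have "r (Suc i) \<le> infdist a F" using a by (simp add: R_def)
      ultimately show "r (Suc i) - r j \<le> dist a b"
        using infdist_triangle[of a F b] by linarith
    qed
    have sum_le: "(\<Sum>i. hausdorff1 (R (2 * i + c))) \<le> hausdorff1 A" for c
    proof -
      have "(\<Sum>i. hausdorff1 (R (2 * i + c))) \<le> hausdorff1 (\<Union>i. R (2 * i + c))"
      proof (rule hausdorff1_separated_sum)
        fix i j :: nat assume "i < j"
        then obtain d where d: "d>0" "\<forall>a\<in>R (2*i+c). \<forall>b\<in>(\<Union>k\<in>{2*j+c..}. R k). d \<le> dist a b"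
          using far[of "2*i+c" "2*j+c"] by auto
        have "\<forall>a\<in>R (2*i+c). \<forall>b\<in>(\<Union>k\<in>{j..}. R (2*k+c)). d \<le> dist a b"
        proof (intro ballI)
          fix a b assume a: "a \<in> R (2*i+c)" and "b \<in> (\<Union>k\<in>{j..}. R (2*k+c))"
          then obtain k where "j \<le> k" "b \<in> R (2*k+c)" by auto
          then have "b \<in> (\<Union>k\<in>{2*j+c..}. R k)" by (intro UN_I[of "2*k+c"]) auto
          with d(2) a show "d \<le> dist a b" by blast
        qed
        then show "\<exists>d>0. \<forall>a\<in>R (2*i+c). \<forall>b\<in>(\<Union>k\<in>{j..}. R (2*k+c)). d \<le> dist a b"
          using d(1) by blast
      qed
      also have "\<dots> \<le> hausdorff1 A" by (rule hausdorff1_mono) (auto simp: R_def)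
      finally show ?thesis .
    qed
    have partial: "(\<Sum>i<n. hausdorff1 (R i)) \<le> hausdorff1 A + hausdorff1 A" for n
    proof -
      have "(\<Sum>i<n. hausdorff1 (R i)) \<le> (\<Sum>i<2*n. hausdorff1 (R i))"
        by (intro sum_mono2) auto
      also have "(\<Sum>i<2*n. hausdorff1 (R i))
          = (\<Sum>i<n. hausdorff1 (R (2*i+0))) + (\<Sum>i<n. hausdorff1 (R (2*i+1)))"
        by (induction n) (auto simp: ac_simps)
      also have "\<dots> \<le> hausdorff1 A + hausdorff1 A"
        by (intro add_mono order_trans[OF sum_le_suminf sum_le]) auto
      finally show ?thesis .
    qed
    define h where "h i = enn2real (hausdorff1 (R i))" for i
    have Rfin: "hausdorff1 (R i) < \<infinity>" for i
      using fin hausdorff1_mono[of "R i" A] by (auto simp: R_def less_top intro: le_less_trans)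
    have h: "hausdorff1 (R i) = ennreal (h i)" "0 \<le> h i" for i
      using Rfin[of i] by (auto simp: h_def)
    obtain a where a: "hausdorff1 A = ennreal a" "0 \<le> a"
      using fin by (cases "hausdorff1 A") auto
    have "(\<Sum>i<n. h i) \<le> a + a" for n
      using partial[of n] a h
      by (simp add: sum_ennreal ennreal_plus[symmetric] del: ennreal_plus)
    then have summ: "summable h"
      by (intro bounded_imp_summable[of h "a + a"]) (auto simp: h lessThan_Suc_atMost[symmetric] simp del: sum.lessThan_Suc)
    have bound: "hausdorff1 (F \<inter> A) + hausdorff1 (A - F)
        \<le> hausdorff1 A + ennreal (\<Sum>i. h (i + n))" for n
    proof -
      have "A - F \<subseteq> S n \<union> (\<Union>i. R (i + n))"
      proof
        fix x assume x: "x \<in> A - F"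
        show "x \<in> S n \<union> (\<Union>i. R (i + n))"
        proof (cases "r n \<le> infdist x F")
          case False
          have pos: "0 < infdist x F"
            using x assms ne by (metis DiffD2 in_closed_iff_infdist_zero infdist_nonneg less_le)
          have "\<exists>m. r m \<le> infdist x F"
            using reals_Archimedean[OF pos] by (auto simp: r_def inverse_eq_divide add.commute intro: less_imp_le)
          define m where "m = (LEAST m. r m \<le> infdist x F)"
          have m: "r m \<le> infdist x F"
            unfolding m_def by (rule LeastI_ex) fact
          have nm: "n < m"
          proof (rule ccontr)
            assume "\<not> n < m"
            then have "r n \<le> r m" using r_anti[of m n] by (cases "m = n") auto
            with m False show False by linarith
          qed
          have "\<not> r (m - 1) \<le> infdist x F"
            using not_less_Least[of "m - 1" "\<lambda>m. r m \<le> infdist x F"] nm by (auto simp: m_def)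
          then have "x \<in> R (m - 1)" using m nm x by (auto simp: R_def)
          moreover have "m - 1 = (m - 1 - n) + n" using nm by auto
          ultimately have "x \<in> R ((m - 1 - n) + n)" by simp
          then show ?thesis by blast
        qed (use x in \<open>auto simp: S_def\<close>)
      qed
      then have "hausdorff1 (A - F) \<le> hausdorff1 (S n \<union> (\<Union>i. R (i + n)))"
        by (rule hausdorff1_mono)
      also have "\<dots> \<le> hausdorff1 (S n) + hausdorff1 (\<Union>i. R (i + n))"
        by (rule hausdorff1_Un_le)
      also have "\<dots> \<le> hausdorff1 (S n) + (\<Sum>i. hausdorff1 (R (i + n)))"
        by (intro add_left_mono hausdorff1_subadditive)
      also have "(\<Sum>i. hausdorff1 (R (i + n))) = ennreal (\<Sum>i. h (i + n))"
        unfolding h(1) by (rule suminf_ennreal2) (use summ h in \<open>auto simp: summable_iff_shift\<close>)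
      finally have "hausdorff1 (F \<inter> A) + hausdorff1 (A - F)
          \<le> (hausdorff1 (F \<inter> A) + hausdorff1 (S n)) + ennreal (\<Sum>i. h (i + n))"
        by (simp add: add.assoc add_left_mono)
      also have "hausdorff1 (F \<inter> A) + hausdorff1 (S n) \<le> hausdorff1 ((F \<inter> A) \<union> S n)"
      proof (rule hausdorff1_metric[OF r_pos[of n]])
        fix y x assume "y \<in> F \<inter> A" "x \<in> S n"
        then show "r n \<le> dist y x"
          using infdist_le[of y F x] by (auto simp: S_def dist_commute)
      qed
      also have "\<dots> \<le> hausdorff1 A" by (rule hausdorff1_mono) (auto simp: S_def)
      finally show ?thesis by (simp add: add_right_mono)
    qed
    have "(\<lambda>n. \<Sum>i. h (i + n)) \<longlonglongrightarrow> 0"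
      using suminf_exist_split2[OF summ] .
    then have "(\<lambda>n. hausdorff1 A + ennreal (\<Sum>i. h (i + n))) \<longlonglongrightarrow> hausdorff1 A + ennreal 0"
      by (intro tendsto_add tendsto_const tendsto_ennrealI) 
    then show ?thesis
      by (intro LIMSEQ_le_const) (use bound in auto)
  qed simp
  have "hausdorff1 (F \<inter> A) + hausdorff1 ((UNIV - F) \<inter> A) = hausdorff1 A" for A :: "'a set"
  proof (rule antisym)
    have "(UNIV - F) \<inter> A = A - F" by auto
    then show "hausdorff1 (F \<inter> A) + hausdorff1 ((UNIV - F) \<inter> A) \<le> hausdorff1 A"
      using le[of A] by simp
    have "hausdorff1 A \<le> hausdorff1 ((F \<inter> A) \<union> ((UNIV - F) \<inter> A))"
      by (rule hausdorff1_mono) auto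
    then show "hausdorff1 A \<le> hausdorff1 (F \<inter> A) + hausdorff1 ((UNIV - F) \<inter> A)"
      by (rule order_trans) (rule hausdorff1_Un_le)
  qed
  then show ?thesis by (simp add: lambda_system_def)
qed

lemma hausdorff1_countably_additive:
  "countably_additive (sets (borel :: 'a::metric_space measure)) hausdorff1"
proof -
  let ?L = "lambda_system UNIV UNIV (hausdorff1 :: 'a set \<Rightarrow> ennreal)"
  have L: "measure_space UNIV ?L hausdorff1"
    using sigma_algebra.caratheodory_lemma[OF sigma_algebra_Pow, of UNIV hausdorff1]
      hausdorff1_outer_measure_space by simp
  then interpret sigma_algebra UNIV ?L by (simp add: measure_space_def)
  have "sets (borel :: 'a measure) = sigma_sets UNIV (Collect closed)"
    by (simp add: borel_eq_closed)
  also have "\<dots> \<subseteq> ?L"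
    by (rule sigma_sets_subset) (use hausdorff1_closed_in_lambda_system in auto)
  finally show ?thesis
    using L by (auto simp: measure_space_def countably_additive_def)
qed

lemma closed_normal_points:
  fixes K C :: "'a::euclidean_space set"
  assumes "compact K" "closed C"
  shows "closed {x \<in> K. \<exists>u\<in>C. outer_unit_normal K x u}"
proof -
  let ?T = "(K \<times> (C \<inter> sphere 0 1)) \<inter> (\<Inter>y\<in>K. {p. y \<bullet> snd p \<le> fst p \<bullet> snd p})"
  have "closed (\<Inter>y\<in>K. {p::'a \<times> 'a. y \<bullet> snd p \<le> fst p \<bullet> snd p})"
    by (intro closed_INT ballI closed_Collect_le continuous_intros)
  then have "compact ?T"
    using assms by (intro compact_Int_closed compact_Times closed_Int_compact) auto
  then have "compact (fst ` ?T)" by (intro compact_continuous_image continuous_intros)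
  moreover have "fst ` ?T = {x \<in> K. \<exists>u\<in>C. outer_unit_normal K x u}"
    by (force simp: outer_unit_normal_def)
  ultimately show ?thesis by (simp add: compact_imp_closed)
qed

lemma closed_distant_normal_points:
  fixes K :: "'a::euclidean_space set"
  assumes "compact K"
  shows "closed {x \<in> K. \<exists>u v. outer_unit_normal K x u \<and> outer_unit_normal K x v \<and> e \<le> dist u v}"
proof -
  let ?T = "(K \<times> (sphere 0 1 \<times> sphere 0 1)) \<inter> {p. e \<le> dist (fst (snd p)) (snd (snd p))} \<inter>
    (\<Inter>y\<in>K. {p. y \<bullet> fst (snd p) \<le> fst p \<bullet> fst (snd p)}
       \<inter> {p. y \<bullet> snd (snd p) \<le> fst p \<bullet> snd (snd p)})"
  have "closed (\<Inter>y\<in>K. {p::'a \<times> 'a \<times> 'a. y \<bullet> fst (snd p) \<le> fst p \<bullet> fst (snd p)}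
       \<inter> {p. y \<bullet> snd (snd p) \<le> fst p \<bullet> snd (snd p)})"
    by (intro closed_INT ballI closed_Int closed_Collect_le continuous_intros)
  moreover have "closed {p::'a \<times> 'a \<times> 'a. e \<le> dist (fst (snd p)) (snd (snd p))}"
    by (intro closed_Collect_le continuous_intros)
  ultimately have "compact ?T"
    using assms by (intro compact_Int_closed compact_Times) auto
  then have "compact (fst ` ?T)" by (intro compact_continuous_image continuous_intros)
  moreover have "fst ` ?T = {x \<in> K. \<exists>u v. outer_unit_normal K x u \<and> outer_unit_normal K x v \<and> e \<le> dist u v}"
  proof (intro equalityI subsetI)
    fix x assume "x \<in> {x \<in> K. \<exists>u v. outer_unit_normal K x u \<and> outer_unit_normal K x v \<and> e \<le> dist u v}"
    then obtain u v where "x \<in> K" "outer_unit_normal K x u" "outer_unit_normal K x v" "e \<le> dist u v"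
      by blast
    then have "(x, u, v) \<in> ?T" by (simp add: outer_unit_normal_def)
    then show "x \<in> fst ` ?T" by (rule rev_image_eqI) simp
  next
    fix x assume "x \<in> fst ` ?T"
    then obtain u v where "(x, u, v) \<in> ?T" by auto
    then have "x \<in> K" "outer_unit_normal K x u" "outer_unit_normal K x v" "e \<le> dist u v"
      by (simp_all add: outer_unit_normal_def)
    then show "x \<in> {x \<in> K. \<exists>u v. outer_unit_normal K x u \<and> outer_unit_normal K x v \<and> e \<le> dist u v}"
      by blast
  qed
  ultimately show ?thesis by (simp add: compact_imp_closed)
qed

lemma normal_map_eqI: "x \<in> regular_bdry K \<Longrightarrow> outer_unit_normal K x u \<Longrightarrow> normal_map K x = u"
  by (auto simp: regular_bdry_def normal_map_def)

lemma normal_map_outer: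
  assumes "x \<in> regular_bdry K"
  shows "outer_unit_normal K x (normal_map K x)"
proof -
  have "\<exists>!u. outer_unit_normal K x u" using assms by (simp add: regular_bdry_def)
  then show ?thesis unfolding normal_map_def by (rule theI')
qed

lemma regular_bdry_borel:
  fixes K :: "'a::euclidean_space set"
  assumes "compact K"
  shows "regular_bdry K \<in> sets borel"
proof -
  let ?N = "{x \<in> K. \<exists>u\<in>UNIV. outer_unit_normal K x u}"
  let ?D = "\<lambda>n::nat. {x \<in> K. \<exists>u v. outer_unit_normal K x u \<and> outer_unit_normal K x v
                        \<and> inverse (real (Suc n)) \<le> dist u v}"
  have fr: "frontier K \<subseteq> K" using assms by (simp add: compact_imp_closed frontier_subset_closed)
  have *: "\<exists>n. inverse (real (Suc n)) \<le> dist u v" if "u \<noteq> v" for u v :: 'a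
    using reals_Archimedean[of "dist u v"] that by (auto intro: less_imp_le)
  have "regular_bdry K = frontier K \<inter> ?N - (\<Union>n. ?D n)"
  proof (intro equalityI subsetI)
    fix x assume x: "x \<in> regular_bdry K"
    then obtain u where u: "outer_unit_normal K x u"
      and uniq: "\<And>v. outer_unit_normal K x v \<Longrightarrow> v = u"
      by (auto simp: regular_bdry_def)
    have "x \<notin> ?D n" for n
    proof
      assume "x \<in> ?D n"
      then obtain v w where "outer_unit_normal K x v" "outer_unit_normal K x w"
        "inverse (real (Suc n)) \<le> dist v w" by auto
      then show False using uniq[of v] uniq[of w] by auto
    qed
    then have "x \<notin> (\<Union>n. ?D n)" by blast
    moreover have "x \<in> frontier K" using x by (simp add: regular_bdry_def)
    ultimately show "x \<in> frontier K \<inter> ?N - (\<Union>n. ?D n)"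
      using u fr by blast
  next
    fix x assume x: "x \<in> frontier K \<inter> ?N - (\<Union>n. ?D n)"
    then obtain u where u: "outer_unit_normal K x u" by auto
    have "v = u" if "outer_unit_normal K x v" for v
      using x u that *[of v u] by blast
    with u have "\<exists>!u. outer_unit_normal K x u" by (intro ex1I)
    with x show "x \<in> regular_bdry K" by (simp add: regular_bdry_def)
  qed
  moreover have "closed ?N" by (rule closed_normal_points[OF assms closed_UNIV])
  moreover have "closed (?D n)" for n by (rule closed_distant_normal_points[OF assms])
  moreover have "closed (frontier K)" by simp
  ultimately show ?thesis
    by (simp add: borel_closed sets.Diff sets.Int sets.countable_UN image_subset_iff del: UN_simps)
qed

lemma normal_map_preimage_borel:
  fixes K :: "'a::euclidean_space set"
  assumes "compact K" "\<omega> \<in> sets borel"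
  shows "{x \<in> regular_bdry K. normal_map K x \<in> \<omega>} \<in> sets borel"
proof -
  have "\<omega> \<in> sigma_sets UNIV (Collect closed)"
    using assms(2) by (simp add: borel_eq_closed)
  then show ?thesis
  proof induction
    case (Basic C)
    have "{x \<in> regular_bdry K. normal_map K x \<in> C}
        = regular_bdry K \<inter> {x \<in> K. \<exists>u\<in>C. outer_unit_normal K x u}"
    proof (intro equalityI subsetI)
      fix x assume x: "x \<in> {x \<in> regular_bdry K. normal_map K x \<in> C}"
      then have "x \<in> K"
        using frontier_subset_closed[OF compact_imp_closed[OF assms(1)]]
        by (auto simp: regular_bdry_def)
      then show "x \<in> regular_bdry K \<inter> {x \<in> K. \<exists>u\<in>C. outer_unit_normal K x u}"
        using x normal_map_outer[of x K] by auto
    next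
      fix x assume "x \<in> regular_bdry K \<inter> {x \<in> K. \<exists>u\<in>C. outer_unit_normal K x u}"
      then show "x \<in> {x \<in> regular_bdry K. normal_map K x \<in> C}"
        using normal_map_eqI[of x K] by auto
    qed
    then show ?case
      using closed_normal_points[OF assms(1), of C] regular_bdry_borel[OF assms(1)] Basic by auto
  next
    case (Compl A)
    have "{x \<in> regular_bdry K. normal_map K x \<in> UNIV - A}
        = regular_bdry K - {x \<in> regular_bdry K. normal_map K x \<in> A}" by auto
    then show ?case using Compl regular_bdry_borel[OF assms(1)] by auto
  next
    case (Union A)
    have "{x \<in> regular_bdry K. normal_map K x \<in> (\<Union>i. A i)}
        = (\<Union>i. {x \<in> regular_bdry K. normal_map K x \<in> A i})" by auto
    then show ?case using Union by auto
  qed simp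
qed

lemma sets_surface_area_measure [simp]: "sets (surface_area_measure K) = sets circle_borel"
proof -
  have sp: "space circle_borel = sphere 0 1" by (simp add: space_restrict_space)
  have "sets (surface_area_measure K) = sigma_sets (sphere 0 1) (sets circle_borel)"
    unfolding surface_area_measure_def
    by (rule sets_measure_of) (use sets.space_closed[of circle_borel] in \<open>unfold sp\<close>)
  also have "\<dots> = sets circle_borel"
    using sets.sigma_sets_eq[of circle_borel] unfolding sp .
  finally show ?thesis .
qed

theorem emeasure_surface_area_measure:
  assumes "compact K" "\<omega> \<in> sets circle_borel"
  shows "emeasure (surface_area_measure K) \<omega> = hausdorff1 {x \<in> regular_bdry K. normal_map K x \<in> \<omega>}"
proof (rule emeasure_measure_of[OF surface_area_measure_def])
  let ?\<mu> = "\<lambda>\<omega>. hausdorff1 {x \<in> regular_bdry K. normal_map K x \<in> \<omega>}"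
  show "sets circle_borel \<subseteq> Pow (sphere 0 1)"
    using sets.space_closed[of circle_borel] unfolding space_restrict_space by simp
  show "\<omega> \<in> sets (surface_area_measure K)" using assms(2) by simp
  show "positive (sets (surface_area_measure K)) ?\<mu>" by (simp add: positive_def)
  show "countably_additive (sets (surface_area_measure K)) ?\<mu>"
  proof (rule countably_additiveI)
    fix A :: "nat \<Rightarrow> (real^2) set"
    assume A: "range A \<subseteq> sets (surface_area_measure K)" "disjoint_family A"
    define B where "B i = {x \<in> regular_bdry K. normal_map K x \<in> A i}" for i
    have "A i \<in> sets borel" for i
    proof -
      have "A i \<in> sets circle_borel" using A(1) by auto
      then show ?thesis by (auto simp: sets_restrict_space)
    qed
    then have B: "range B \<subseteq> sets borel"
      unfolding B_def using normal_map_preimage_borel[OF assms(1)] by auto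
    have "disjoint_family B"
      using A(2) by (auto simp: B_def disjoint_family_on_def)
    then have "(\<Sum>i. hausdorff1 (B i)) = hausdorff1 (\<Union>i. B i)"
      using hausdorff1_countably_additive B sets.countable_UN[OF B]
      unfolding countably_additive_def by auto
    also have "(\<Union>i. B i) = {x \<in> regular_bdry K. normal_map K x \<in> (\<Union>i. A i)}"
      by (auto simp: B_def)
    finally show "(\<Sum>i. ?\<mu> (A i)) = ?\<mu> (\<Union>i. A i)" by (simp add: B_def)
  qed
qed

lemma support_fun_measurable:
  fixes K :: "'a::euclidean_space set"
  assumes "compact K" "K \<noteq> {}"
  shows "support_fun K \<in> borel_measurable borel"
proof -
  have bdd: "bdd_above ((\<lambda>x. x \<bullet> u) ` K)" for u
    by (intro compact_imp_bounded[THEN bounded_imp_bdd_above] compact_continuous_image assms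
        continuous_intros)
  have "{u. support_fun K u \<le> a} = (\<Inter>x\<in>K. {u. x \<bullet> u \<le> a})" for a
    unfolding support_fun_def using assms(2) by (auto simp: cSUP_le_iff[OF _ bdd])
  moreover have "closed (\<Inter>x\<in>K. {u. x \<bullet> u \<le> a})" for a
    by (intro closed_INT ballI closed_Collect_le continuous_intros)
  ultimately show ?thesis
    by (intro borel_measurable_iff_le[THEN iffD2]) auto
qed

end

theory Submission
  imports Defs
begin

text \<open>If \<open>S\<^sub>-\<^sub>2(P)\<close> is the given measure, then \<open>S\<^sub>P\<close> is concentrated on the four directions \<open>u\<^sub>i\<close>,
  which forces \<open>P\<close> to be the polygon cut out by the supporting lines at distances \<open>h\<^sub>i\<close>, with sides
  of length \<open>h\<^sub>i\<^sup>-\<^sup>3\<close>. This polygon is a trapezoid with parallel sides normal to \<open>u\<^sub>1\<close> and \<open>u\<^sub>3\<close>, whose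
  legs have equal lengths, so \<open>h\<^sub>2 = h\<^sub>4\<close>; the remaining three length equations have no positive
  solution.\<close>

section \<open>One-dimensional Hausdorff measure of segments and countable sets\<close>

text \<open>Any cover of \<open>A\<close>, cut down to \<open>A\<close> (where \<open>f\<close> is
  controlled) and then mapped by \<open>f\<close>, covers the image with pieces of no larger
  diameter.\<close>

lemma hausdorff1_nonexpansive_image_le:
  fixes f :: "'a::metric_space \<Rightarrow> 'b::metric_space"
  assumes f: "\<And>x y. x \<in> A \<Longrightarrow> y \<in> A \<Longrightarrow> dist (f x) (f y) \<le> dist x y"
  shows "hausdorff1 (f ` A) \<le> hausdorff1 A"
  unfolding hausdorff1_def
proof (rule SUP_mono)
  fix \<delta> :: real assume "\<delta> \<in> {0<..}"
  then have \<delta>: "\<delta> > 0" by simp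
  have "hausdorff1_pre \<delta> (f ` A) \<le> hausdorff1_pre \<delta> A"
    unfolding hausdorff1_pre_def[of _ A]
  proof (rule INF_greatest, clarify)
    fix C :: "nat \<Rightarrow> 'a set"
    assume cov: "A \<subseteq> (\<Union>i. C i)" and C: "\<forall>i. bounded (C i) \<and> diameter (C i) \<le> \<delta>"
    define D where "D i = f ` (A \<inter> C i)" for i
    have D: "dist u v \<le> diameter (C i)" if "u \<in> D i" "v \<in> D i" for u v i
    proof -
      obtain x y where "x \<in> A \<inter> C i" "y \<in> A \<inter> C i" "u = f x" "v = f y"
        using \<open>u \<in> D i\<close> \<open>v \<in> D i\<close> by (auto simp: D_def)
      then show ?thesis
        using f[of x y] diameter_bounded_bound[of "C i" x y] C by force
    qed
    have bD: "bounded (D i)" for i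
      unfolding bounded_two_points using D by blast
    have dD: "diameter (D i) \<le> diameter (C i)" for i
    proof (cases "D i = {}")
      case True
      then show ?thesis using diameter_ge_0[of "C i"] C by (simp add: diameter_empty)
    next
      case False
      then have "diameter (D i) = (SUP (u, v)\<in>D i \<times> D i. dist u v)" by (simp add: diameter_def)
      also have "\<dots> \<le> diameter (C i)" using False D by (intro cSUP_least) auto
      finally show ?thesis .
    qed
    have "f ` A \<subseteq> (\<Union>i. D i)" using cov by (fastforce simp: D_def)
    moreover have "\<forall>i. bounded (D i) \<and> diameter (D i) \<le> \<delta>"
      using bD dD C by (meson order_trans)
    ultimately have "hausdorff1_pre \<delta> (f ` A) \<le> (\<Sum>i. ennreal (diameter (D i)))"
      unfolding hausdorff1_pre_def by (intro INF_lower) auto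
    also have "\<dots> \<le> (\<Sum>i. ennreal (diameter (C i)))"
      by (intro suminf_le ennreal_leI dD) auto
    finally show "hausdorff1_pre \<delta> (f ` A) \<le> (\<Sum>i. ennreal (diameter (C i)))" .
  qed
  with \<delta> show "\<exists>m\<in>{0<..}. hausdorff1_pre \<delta> (f ` A) \<le> hausdorff1_pre m A" by auto
qed

text \<open>A bounded set of reals lies in the interval from its infimum to its supremum, which is
  no longer than its diameter. Countable subadditivity then bounds the Lebesgue measure by every
  admissible cover sum; the scale 1 is an arbitrary choice.\<close>

lemma emeasure_lborel_le_hausdorff1:
  fixes A :: "real set"
  assumes "A \<in> sets borel"
  shows "emeasure lborel A \<le> hausdorff1 A"
proof -
  have "emeasure lborel A \<le> hausdorff1_pre 1 A"
    unfolding hausdorff1_pre_def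
  proof (rule INF_greatest, clarify)
    fix C :: "nat \<Rightarrow> real set"
    assume cov: "A \<subseteq> (\<Union>i. C i)" and C: "\<forall>i. bounded (C i) \<and> diameter (C i) \<le> 1"
    \<comment> \<open>Empty cover sets stay empty, since \<open>Inf {}\<close> and
      \<open>Sup {}\<close> carry no information.\<close>
    define D where "D i = (if C i = {} then {} else {Inf (C i)..Sup (C i)})" for i
    have D: "C i \<subseteq> D i" for i
      using C bounded_imp_bdd_above[of "C i"] bounded_imp_bdd_below[of "C i"]
      by (auto simp: D_def intro: cInf_lower cSup_upper)
    have len: "emeasure lborel (D i) \<le> ennreal (diameter (C i))" for i
    proof (cases "C i = {}")
      case False
      have b: "bounded (C i)" "bdd_above (C i)" "bdd_below (C i)"
        using C bounded_imp_bdd_above[of "C i"] bounded_imp_bdd_below[of "C i"] by auto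
      \<comment> \<open>The endpoints need not belong to \<open>C i\<close>, but they belong to its
        closure, which has the same diameter.\<close>
      have "Sup (C i) \<in> closure (C i)" "Inf (C i) \<in> closure (C i)"
        using False b by (auto intro: closure_contains_Sup closure_contains_Inf)
      then have "dist (Sup (C i)) (Inf (C i)) \<le> diameter (closure (C i))"
        using b by (intro diameter_bounded_bound bounded_closure) auto
      also have "\<dots> = diameter (C i)" using b by (simp add: diameter_closure)
      finally have "Sup (C i) - Inf (C i) \<le> diameter (C i)" by (simp add: dist_real_def)
      moreover have "Inf (C i) \<le> Sup (C i)"
        using False b by (intro cInf_le_cSup)
      ultimately show ?thesis using False by (simp add: D_def ennreal_leI)
    qed (simp add: D_def)
    have "emeasure lborel A \<le> emeasure lborel (\<Union>i. D i)"
      using cov D by (intro emeasure_mono) (fastforce, auto simp: D_def)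
    also have "\<dots> \<le> (\<Sum>i. emeasure lborel (D i))"
      by (intro emeasure_subadditive_countably) (auto simp: D_def)
    also have "\<dots> \<le> (\<Sum>i. ennreal (diameter (C i)))"
      by (intro suminf_le len) auto
    finally show "emeasure lborel A \<le> (\<Sum>i. ennreal (diameter (C i)))" .
  qed
  also have "\<dots> \<le> hausdorff1 A" by (rule hausdorff1_pre_le) simp
  finally show ?thesis .
qed

text \<open>Lebesgue measure gives the lower bound. For the upper bound, cutting into
  \<open>n\<close> equal pieces of width at most \<open>\<delta>\<close> gives a cover whose
  diameters add up to exactly \<open>b - a\<close>.\<close>

lemma hausdorff1_Icc:
  fixes a b :: real
  assumes "a \<le> b"
  shows "hausdorff1 {a..b} = ennreal (b - a)"
proof (rule antisym)
  show "ennreal (b - a) \<le> hausdorff1 {a..b}"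
    using emeasure_lborel_le_hausdorff1[of "{a..b}"] assms by simp
  show "hausdorff1 {a..b} \<le> ennreal (b - a)"
    unfolding hausdorff1_def
  proof (rule SUP_least)
    fix \<delta> :: real assume "\<delta> \<in> {0<..}"
    then have \<delta>: "\<delta> > 0" by simp
    obtain n :: nat where n: "(b - a) / \<delta> < real n" using reals_Archimedean2 by blast
    have n0: "n > 0" using n \<delta> assms by (cases n) (auto simp: field_simps)
    define w where "w = (b - a) / n"
    have w: "w \<ge> 0" "w \<le> \<delta>" "n * w = b - a"
      using n n0 \<delta> assms by (auto simp: w_def field_simps)
    define C where "C i = (if i < n then {a + i * w..a + Suc i * w} else {})" for i
    have dC: "diameter (C i) = (if i < n then w else 0)" for i
      using w by (auto simp: C_def algebra_simps)
    have cov: "{a..b} \<subseteq> (\<Union>i. C i)"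
    proof
      fix x assume x: "x \<in> {a..b}"
      show "x \<in> (\<Union>i. C i)"
      \<comment> \<open>The right endpoint is separate: for \<open>a < b\<close> the floor formula
        below would assign it the index \<open>n\<close>, one past the last piece. Excluding it also
        ensures that the width is positive.\<close>
      proof (cases "x = b")
        case True
        moreover have "real (Suc (n - 1)) = n" using n0 by simp
        then have "a + real (Suc (n - 1)) * w = b" using w by simp
        moreover have "real (n - 1) * w \<le> real n * w" using w by (intro mult_right_mono) auto
        then have "a + real (n - 1) * w \<le> b" using w by linarith
        ultimately have "x \<in> C (n - 1)" using n0 unfolding C_def by (simp del: of_nat_Suc)
        then show ?thesis by blast
      next
        case False
        then have wp: "w > 0" using x n0 by (auto simp: w_def)
        define i where "i = nat \<lfloor>(x - a) / w\<rfloor>"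
        have "real i = of_int \<lfloor>(x - a) / w\<rfloor>" using x wp by (simp add: i_def)
        then have i: "real i \<le> (x - a) / w" "(x - a) / w < real i + 1" by linarith+
        then have i': "i * w \<le> x - a" "x - a < (real i + 1) * w" using wp by (auto simp: field_simps)
        have "i * w < n * w" using i' x False w by auto
        then have "i < n" using wp by simp
        then have "x \<in> C i" using i' by (auto simp: C_def algebra_simps)
        then show ?thesis by blast
      qed
    qed
    have "bounded (C i) \<and> diameter (C i) \<le> \<delta>" for i
      unfolding dC using w \<delta> by (auto simp: C_def)
    then have "hausdorff1_pre \<delta> {a..b} \<le> (\<Sum>i. ennreal (diameter (C i)))"
      unfolding hausdorff1_pre_def using cov by (intro INF_lower) auto
    also have "\<dots> = (\<Sum>i<n. ennreal (diameter (C i)))"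
      by (rule suminf_finite) (auto simp: dC)
    also have "\<dots> = ennreal (\<Sum>i<n. w)"
      using w by (subst sum_ennreal[symmetric]) (auto simp: dC)
    also have "\<dots> = ennreal (b - a)" using w by simp
    finally show "hausdorff1_pre \<delta> {a..b} \<le> ennreal (b - a)" .
  qed
qed

text \<open>The parametrisation is an isometry, and projection to the direction \<open>e\<close> is
  a nonexpansive left inverse of it, so segment and interval bound each other.\<close>

lemma hausdorff1_segment:
  fixes a e :: "'a::real_inner"
  assumes e: "norm e = 1" and "s \<le> t"
  shows "hausdorff1 ((\<lambda>r. a + r *\<^sub>R e) ` {s..t}) = ennreal (t - s)"
proof (rule antisym)
  let ?f = "\<lambda>r. a + r *\<^sub>R e"
  have iso: "dist (?f r) (?f r') = dist r r'" for r r'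
    using e by (simp add: dist_norm flip: scaleR_diff_left)
  show "hausdorff1 (?f ` {s..t}) \<le> ennreal (t - s)"
    using hausdorff1_nonexpansive_image_le[of "{s..t}" ?f] hausdorff1_Icc[OF \<open>s \<le> t\<close>] iso by simp
  have "{s..t} = (\<lambda>x. (x - a) \<bullet> e) ` ?f ` {s..t}"
    using e by (simp add: image_image dot_square_norm)
  moreover have "hausdorff1 ((\<lambda>x. (x - a) \<bullet> e) ` ?f ` {s..t}) \<le> hausdorff1 (?f ` {s..t})"
  proof (rule hausdorff1_nonexpansive_image_le)
    fix x y :: 'a
    have "\<bar>(x - y) \<bullet> e\<bar> \<le> norm (x - y) * norm e" by (rule Cauchy_Schwarz_ineq2)
    then show "dist ((x - a) \<bullet> e) ((y - a) \<bullet> e) \<le> dist x y"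
      using e by (simp add: dist_norm inner_diff_left)
  qed
  ultimately show "ennreal (t - s) \<le> hausdorff1 (?f ` {s..t})"
    using hausdorff1_Icc[OF \<open>s \<le> t\<close>] by simp
qed

lemma hausdorff1_singleton [simp]: "hausdorff1 {x} = 0"
  using hausdorff1_nonexpansive_image_le[of "{0::real..0}" "\<lambda>_. x"] hausdorff1_Icc[of 0 0] by simp

lemma hausdorff1_countable:
  assumes "countable A"
  shows "hausdorff1 A = 0"
proof (cases "A = {}")
  case False
  then have "A = (\<Union>i. {from_nat_into A i})" using assms by (simp add: UNION_singleton_eq_range)
  then have "hausdorff1 A \<le> (\<Sum>i::nat. hausdorff1 {from_nat_into A i})"
    using hausdorff1_subadditive[of "\<lambda>i. {from_nat_into A i}"] by simp
  then show ?thesis by simp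
qed simp

lemma hausdorff1_Un_null:
  assumes "hausdorff1 N = 0"
  shows "hausdorff1 (A \<union> N) = hausdorff1 A"
  using hausdorff1_Un_le[of A N] hausdorff1_mono[of A "A \<union> N"] assms
  by (simp add: antisym)

section \<open>Support functions and outer normals\<close>

lemma inner_le_support_fun:
  assumes "compact K" "x \<in> K"
  shows "x \<bullet> v \<le> support_fun K v"
proof -
  have "bdd_above ((\<lambda>x. x \<bullet> v) ` K)"
    by (intro compact_imp_bounded[THEN bounded_imp_bdd_above] compact_continuous_image assms
        continuous_intros)
  then show ?thesis unfolding support_fun_def by (intro cSUP_upper assms)
qed

lemma outer_unit_normal_iff_support_fun:
  assumes "compact K" "x \<in> K"
  shows "outer_unit_normal K x v \<longleftrightarrow> norm v = 1 \<and> x \<bullet> v = support_fun K v"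
proof -
  have "support_fun K v \<le> x \<bullet> v" if "\<forall>y\<in>K. y \<bullet> v \<le> x \<bullet> v"
    unfolding support_fun_def using that assms(2) by (auto intro!: cSUP_least)
  then show ?thesis
    unfolding outer_unit_normal_def using inner_le_support_fun[OF assms(1)] assms(2) by (metis antisym)
qed

text \<open>A small ball about the origin inside \<open>K\<close> contains a point in the direction
  of \<open>v\<close>.\<close>

lemma support_fun_pos:
  fixes K :: "'a::euclidean_space set"
  assumes "compact K" "0 \<in> interior K" "v \<noteq> 0"
  shows "support_fun K v > 0"
proof -
  obtain e where e: "e > 0" "cball 0 e \<subseteq> K"
    using assms(2) by (auto simp: mem_interior_cball)
  have "(e / norm v) *\<^sub>R v \<in> K" using e assms(3) by (auto intro!: subsetD[OF e(2)])
  then have "(e / norm v) *\<^sub>R v \<bullet> v \<le> support_fun K v" by (rule inner_le_support_fun[OF assms(1)])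
  moreover have "(e / norm v) *\<^sub>R v \<bullet> v > 0" using e assms(3) by simp
  ultimately show ?thesis by linarith
qed

lemma frontier_outer_unit_normal:
  fixes K :: "'a::euclidean_space set"
  assumes "convex_body K" "x \<in> frontier K"
  shows "\<exists>v. outer_unit_normal K x v"
proof -
  have K: "compact K" "convex K" "interior K \<noteq> {}" using assms(1) by (auto simp: convex_body_def)
  have "x \<in> closure K" "x \<notin> rel_interior K"
    using assms(2) K rel_interior_interior[of K] interior_rel_interior_gen[of K]
    by (auto simp: frontier_def rel_interior_nonempty_interior)
  then obtain a where a: "a \<noteq> 0" "\<And>y. y \<in> closure K \<Longrightarrow> a \<bullet> x \<le> a \<bullet> y"
    using supporting_hyperplane_relative_frontier[OF K(2)] by metis
  \<comment> \<open>The supporting functional \<open>a\<close> attains its minimum over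
    \<open>K\<close> at \<open>x\<close>, so the outer normal is its normalised negative.\<close>
  have "outer_unit_normal K x ((- 1 / norm a) *\<^sub>R a)"
    unfolding outer_unit_normal_def
    using a subsetD[OF closure_subset, of _ K] by (auto simp: inner_commute divide_right_mono)
  then show ?thesis by blast
qed

section \<open>Irregular boundary points\<close>

lemma unit_vectors_orthogonal_to_same:
  fixes a v w :: "real^2"
  assumes "a \<noteq> 0" "a \<bullet> v = 0" "a \<bullet> w = 0" "norm v = 1" "norm w = 1"
  shows "v = w \<or> v = - w"
proof -
  have 1: "a$1 * v$1 + a$2 * v$2 = 0" "a$1 * w$1 + a$2 * w$2 = 0"
    using assms by (simp_all add: inner_vec_def sum_2)
  have 2: "(v$1)\<^sup>2 + (v$2)\<^sup>2 = 1" "(w$1)\<^sup>2 + (w$2)\<^sup>2 = 1"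
    using assms(4,5) by (simp_all add: norm_vec_def L2_set_def sum_2)
  have "a$1 \<noteq> 0 \<or> a$2 \<noteq> 0" using assms(1) by (simp add: vec_eq_iff forall_2)
  moreover have "a$1 * (v$1 * w$2 - v$2 * w$1) = 0" "a$2 * (v$1 * w$2 - v$2 * w$1) = 0"
    using 1 by algebra+
  ultimately have 3: "v$1 * w$2 - v$2 * w$1 = 0" by auto
  \<comment> \<open>Lagrange's identity: the squares of inner product and determinant of two unit
    vectors add up to 1, and the determinant was just shown to vanish.\<close>
  have "(v$1 * w$1 + v$2 * w$2)\<^sup>2 = 1" using 2 3 by algebra
  then have "v$1 * w$1 + v$2 * w$2 = 1 \<or> v$1 * w$1 + v$2 * w$2 = - 1"
    by (simp add: power2_eq_1_iff)
  then have "v \<bullet> w = 1 \<or> v \<bullet> w = -1" by (simp add: inner_vec_def sum_2)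
  moreover have "v \<bullet> v = 1" "w \<bullet> w = 1" using assms(4,5) by (simp_all add: dot_square_norm)
  ultimately have "(v - w) \<bullet> (v - w) = 0 \<or> (v + w) \<bullet> (v + w) = 0"
    by (simp add: inner_diff inner_add inner_commute del: inner_eq_zero_iff) linarith
  then show ?thesis by (simp add: eq_neg_iff_add_eq_0)
qed

text \<open>Distinct irregular points have normal cones with disjoint nonempty interiors.\<close>

lemma countable_irregular:
  fixes K :: "(real^2) set"
  assumes "convex_body K"
  shows "countable (frontier K - regular_bdry K)"
proof -
  have K: "compact K" "interior K \<noteq> {}" using assms by (auto simp: convex_body_def)
  have fr: "frontier K \<subseteq> K" using K by (simp add: compact_imp_closed frontier_subset_closed)
  \<comment> \<open>The normal cone at \<open>x\<close>; without normalisation of \<open>w\<close>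
    it is convex and can have interior.\<close>
  define N where "N x = {w. \<forall>y\<in>K. y \<bullet> w \<le> x \<bullet> w}" for x
  let ?I = "frontier K - regular_bdry K"
  have ne: "interior (N x) \<noteq> {}" if x: "x \<in> ?I" for x
  proof
    assume empty: "interior (N x) = {}"
    obtain v where v: "outer_unit_normal K x v"
      using frontier_outer_unit_normal[OF assms] x by blast
    with x obtain w where w: "outer_unit_normal K x w" "w \<noteq> v"
      unfolding regular_bdry_def by blast
    \<comment> \<open>A convex set with empty interior lies in a hyperplane, which here passes
      through the origin. Two distinct unit normals on that line are opposite, which would flatten
      \<open>K\<close> into a line.\<close>
    have "convex (N x)"
      unfolding N_def convex_def by (auto simp: inner_add_right intro!: add_mono mult_left_mono)
    then obtain a b where a: "a \<noteq> 0" "N x \<subseteq> {z. a \<bullet> z = b}"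
      using empty_interior_subset_hyperplane[OF _ empty] by blast
    have mem: "0 \<in> N x" "v \<in> N x" "w \<in> N x"
      using v w by (auto simp: N_def outer_unit_normal_def)
    then have "b = 0" using a(2) by auto
    then have "a \<bullet> v = 0" "a \<bullet> w = 0" using a(2) mem by auto
    then have "v = w \<or> v = - w"
      using unit_vectors_orthogonal_to_same a v w by (auto simp: outer_unit_normal_def)
    then have vw: "v = - w" using w by auto
    have "K \<subseteq> {y. w \<bullet> y = x \<bullet> w}"
      using mem unfolding N_def vw by (force simp: inner_commute intro: antisym)
    moreover have "w \<noteq> 0" using w by (auto simp: outer_unit_normal_def)
    ultimately show False using K(2) interior_mono interior_hyperplane by blast
  qed
  have disj: "interior (N x) \<inter> interior (N y) = {}" if "x \<in> K" "y \<in> K" "x \<noteq> y" for x y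
  proof (rule ccontr)
    assume "interior (N x) \<inter> interior (N y) \<noteq> {}"
    then obtain w where "w \<in> interior (N x)" "w \<in> interior (N y)" by blast
    then obtain e where w: "w \<in> N x" "e > 0" "cball w e \<subseteq> N y"
      using interior_subset unfolding mem_interior_cball[of w "N y"] by blast
    \<comment> \<open>Since \<open>w\<close> ranks \<open>x\<close> at least as high as
      \<open>y\<close>, tilting it by \<open>d\<close> towards \<open>x - y\<close> ranks
      \<open>x\<close> strictly higher; yet \<open>w + d\<close> is still in the normal cone of
      \<open>y\<close>.\<close>
    define d where "d = (e / norm (x - y)) *\<^sub>R (x - y)"
    have "w + d \<in> N y" using w that by (intro subsetD[OF w(3)]) (simp add: d_def dist_norm)
    then have "x \<bullet> (w + d) \<le> y \<bullet> (w + d)" using that by (simp add: N_def)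
    moreover have "y \<bullet> w \<le> x \<bullet> w" using w that by (simp add: N_def)
    ultimately have "(x - y) \<bullet> d \<le> 0" by (simp add: algebra_simps)
    moreover have "(x - y) \<bullet> d > 0" using that w by (simp add: d_def)
    ultimately show False by simp
  qed
  have inj: "inj_on (\<lambda>x. interior (N x)) ?I"
    using disj ne fr by (intro inj_onI) (metis DiffD1 inf.idem subsetD)
  have "countable ((\<lambda>x. interior (N x)) ` ?I)"
  proof (rule countable_disjoint_open_subsets)
    show "pairwise disjnt ((\<lambda>x. interior (N x)) ` ?I)"
      using disj fr by (auto simp: pairwise_def disjnt_def)
  qed auto
  then show ?thesis using inj by (rule countable_image_inj_on)
qed

section \<open>The surface area measure and the shape of the boundary\<close>

text \<open>Regular points with normal \<open>v\<close> lie in the face in direction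
  \<open>v\<close>. The rest of the face consists of irregular points, which are countable and hence
  null.\<close>

lemma emeasure_surface_area_measure_singleton:
  assumes K: "convex_body K" and v: "norm v = 1"
  shows "emeasure (surface_area_measure K) {v} = hausdorff1 {x \<in> K. x \<bullet> v = support_fun K v}"
proof -
  have cK: "compact K" using K by (simp add: convex_body_def)
  have fr: "frontier K \<subseteq> K" using cK by (simp add: compact_imp_closed frontier_subset_closed)
  let ?A = "{x \<in> regular_bdry K. normal_map K x \<in> {v}}"
  let ?F = "{x \<in> K. x \<bullet> v = support_fun K v}"
  have "{v} \<in> sets circle_borel" using v by (auto simp: sets_restrict_space)
  then have "emeasure (surface_area_measure K) {v} = hausdorff1 ?A"
    by (rule emeasure_surface_area_measure[OF cK])
  moreover have AF: "?A \<subseteq> ?F"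
  proof
    fix x assume x: "x \<in> ?A"
    then have "x \<in> K" using fr by (auto simp: regular_bdry_def)
    moreover have "outer_unit_normal K x v" using x normal_map_outer[of x K] by auto
    ultimately show "x \<in> ?F" using outer_unit_normal_iff_support_fun[OF cK] by auto
  qed
  have "?F - ?A \<subseteq> frontier K - regular_bdry K"
  proof
    fix x assume x: "x \<in> ?F - ?A"
    then have n: "outer_unit_normal K x v"
      using outer_unit_normal_iff_support_fun[OF cK] v by auto
    have "x \<notin> interior K"
    proof
      assume "x \<in> interior K"
      then obtain e where e: "e > 0" "cball x e \<subseteq> K" by (auto simp: mem_interior_cball)
      then have "x + e *\<^sub>R v \<in> K" using v by (intro subsetD[OF e(2)]) (simp add: dist_norm)
      then have "(x + e *\<^sub>R v) \<bullet> v \<le> x \<bullet> v" using n by (auto simp: outer_unit_normal_def)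
      then show False using e v by (simp add: inner_add_left dot_square_norm)
    qed
    moreover have "x \<notin> regular_bdry K" using x n normal_map_eqI by auto
    ultimately show "x \<in> frontier K - regular_bdry K"
      using x closure_subset by (auto simp: frontier_def)
  qed
  then have "hausdorff1 (?F - ?A) = 0"
    using countable_irregular[OF K] by (intro hausdorff1_countable) (rule countable_subset)
  then have "hausdorff1 (?A \<union> (?F - ?A)) = hausdorff1 ?A" by (rule hausdorff1_Un_null)
  moreover have "?A \<union> (?F - ?A) = ?F" using AF by (rule Diff_partition)
  ultimately show ?thesis by metis
qed

text \<open>The distance from a boundary point \<open>x\<close> maps a neighbourhood of \<open>x\<close> in the boundary onto
  an interval, because every small circle about \<open>x\<close> meets the boundary.\<close>

lemma hausdorff1_frontier_ball_pos:
  fixes K :: "'a::euclidean_space set"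
  assumes K: "convex_body K" and "0 \<in> interior K" "x \<in> frontier K" "e > 0" and dim: "2 \<le> DIM('a)"
  shows "hausdorff1 (frontier K \<inter> ball x e) > 0"
proof -
  have cK: "compact K" "convex K" using K by (auto simp: convex_body_def)
  have x0: "x \<noteq> 0" using assms by (auto simp: frontier_def)
  \<comment> \<open>With radii below \<open>norm x\<close>, the step from \<open>x\<close> towards
    the origin stays on the open segment between them, hence in the interior.\<close>
  define d where "d = min e (norm x)"
  have d: "d > 0" "d \<le> e" "d \<le> norm x" using assms x0 by (auto simp: d_def)
  have "{0<..<d} \<subseteq> (\<lambda>y. dist y x) ` (frontier K \<inter> ball x e)"
  proof
    fix s assume s: "s \<in> {0<..<d}"
    \<comment> \<open>The point at signed distance \<open>r\<close> beyond \<open>x\<close> on the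
      ray from the origin: it lies in \<open>K\<close> for \<open>r = - s\<close> and outside for
      \<open>r = s\<close>. The sphere of radius \<open>s\<close> about \<open>x\<close> contains
      both and, being connected, meets the frontier.\<close>
    let ?p = "\<lambda>r. (1 + r / norm x) *\<^sub>R x"
    have dist: "dist x (?p r) = \<bar>r\<bar>" for r
    proof -
      have "x - ?p r = (- r / norm x) *\<^sub>R x" by (simp add: algebra_simps)
      then show ?thesis using x0 by (simp add: dist_norm del: scaleR_minus_left)
    qed
    have "?p (- s) \<in> open_segment 0 x"
    proof -
      have "0 < 1 - s / norm x" "1 - s / norm x < 1" using s d x0 by (auto simp: field_simps)
      then show ?thesis using x0 unfolding in_segment by (auto intro!: exI[of _ "1 - s / norm x"])
    qed
    then have "?p (- s) \<in> interior K"
      using in_interior_closure_convex_segment[OF cK(2) assms(2), of x] assms(3)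
      by (auto simp: frontier_def)
    then have "?p (- s) \<in> sphere x s \<inter> K" using s dist[of "- s"] interior_subset by auto
    moreover have "?p s \<in> sphere x s - K"
    proof -
      have "?p s \<notin> K"
      proof
        assume "?p s \<in> K"
        then have "open_segment 0 (?p s) \<subseteq> interior K"
          using in_interior_closure_convex_segment[OF cK(2) assms(2)] closure_subset by blast
        moreover have "x \<in> open_segment 0 (?p s)"
        proof -
          have pos: "1 + s / norm x > 1" using x0 s by simp
          then have "1 / (1 + s / norm x) < 1" "1 / (1 + s / norm x) > 0" "?p s \<noteq> 0"
            using x0 by auto
          moreover have "(1 / (1 + s / norm x)) *\<^sub>R ?p s = x" using pos by simp
          ultimately show ?thesis unfolding in_segment by (metis add_0 scaleR_zero_right)
        qed
        ultimately show False using assms(3) by (auto simp: frontier_def)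
      qed
      then show ?thesis using s dist[of s] by simp
    qed
    ultimately have "sphere x s \<inter> frontier K \<noteq> {}"
      using connected_Int_frontier[OF connected_sphere[OF dim, of x s], of K] by blast
    then obtain y where "y \<in> sphere x s" "y \<in> frontier K" by blast
    then have "y \<in> frontier K" "dist x y = s" by simp_all
    then show "s \<in> (\<lambda>y. dist y x) ` (frontier K \<inter> ball x e)"
      using s d by (intro image_eqI[of _ _ y]) (simp_all add: dist_commute)
  qed
  then have "hausdorff1 {0<..<d} \<le> hausdorff1 ((\<lambda>y. dist y x) ` (frontier K \<inter> ball x e))"
    by (rule hausdorff1_mono)
  also have "\<dots> \<le> hausdorff1 (frontier K \<inter> ball x e)"
    by (rule hausdorff1_nonexpansive_image_le)
      (metis dist_real_def abs_dist_diff_le dist_commute)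
  finally have "hausdorff1 {0<..<d} \<le> hausdorff1 (frontier K \<inter> ball x e)" .
  moreover have "0 < ennreal d" using d by simp
  moreover have "ennreal d \<le> hausdorff1 {0<..<d}"
    using emeasure_lborel_le_hausdorff1[of "{0<..<d}"] d by simp
  ultimately show ?thesis by (metis order_less_le_trans)
qed

text \<open>The frontier lies on the supporting lines with normals in \<open>U\<close>: a patch off
  these lines would have positive length, but it contains only irregular points and points with
  normal outside \<open>U\<close>, which form a null set. A point satisfying all inequalities but
  outside \<open>K\<close> is then excluded by following the segment from the origin to it.\<close>

lemma polygon_if_surface_area_measure_finite_support:
  fixes K U :: "(real^2) set"
  assumes K: "convex_body K" and 0: "0 \<in> interior K" and U: "finite U" "U \<subseteq> sphere 0 1"
    and null: "emeasure (surface_area_measure K) (sphere 0 1 - U) = 0"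
  shows "K = {x. \<forall>v\<in>U. x \<bullet> v \<le> support_fun K v}"
proof -
  have cK: "compact K" "convex K" using K by (auto simp: convex_body_def)
  have fr: "frontier K \<subseteq> K" using cK by (simp add: compact_imp_closed frontier_subset_closed)
  define F where "F = (\<Union>v\<in>U. {x. x \<bullet> v = support_fun K v})"
  have "closed F"
    unfolding F_def using U by (intro closed_UN ballI closed_Collect_eq continuous_intros)
  have sub: "frontier K \<subseteq> F"
  proof (rule ccontr)
    assume "\<not> frontier K \<subseteq> F"
    then obtain x where x: "x \<in> frontier K" "x \<notin> F" by blast
    then obtain e where e: "e > 0" "ball x e \<subseteq> - F"
      using \<open>closed F\<close> by (metis ComplI open_Compl openE)
    let ?R = "{x \<in> regular_bdry K. normal_map K x \<in> sphere 0 1 - U}"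
    have "sphere 0 1 - U \<in> sets circle_borel"
      using U by (simp add: sets_restrict_space_iff borel_closed finite_imp_closed sets.Diff Diff_subset)
    then have "hausdorff1 ?R = 0"
      using null emeasure_surface_area_measure[OF cK(1)] by simp
    then have "hausdorff1 ((frontier K - regular_bdry K) \<union> ?R) = 0"
      using hausdorff1_countable[OF countable_irregular[OF K]] by (simp add: hausdorff1_Un_null)
    moreover have "frontier K \<inter> ball x e \<subseteq> (frontier K - regular_bdry K) \<union> ?R"
    proof
      fix y assume y: "y \<in> frontier K \<inter> ball x e"
      then have "y \<notin> F" "y \<in> K" using e fr by auto
      moreover have "outer_unit_normal K y (normal_map K y)" if "y \<in> regular_bdry K"
        using that by (rule normal_map_outer)
      ultimately show "y \<in> (frontier K - regular_bdry K) \<union> ?R"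
        using y outer_unit_normal_iff_support_fun[OF cK(1) \<open>y \<in> K\<close>] by (auto simp: F_def)
    qed
    ultimately have "hausdorff1 (frontier K \<inter> ball x e) = 0"
      using hausdorff1_mono[of "frontier K \<inter> ball x e" "(frontier K - regular_bdry K) \<union> ?R"] by simp
    moreover have "hausdorff1 (frontier K \<inter> ball x e) > 0"
      using K 0 x(1) e(1) by (rule hausdorff1_frontier_ball_pos) simp
    ultimately show False by simp
  qed
  show ?thesis
  proof (intro equalityI subsetI)
    fix x assume x: "x \<in> {x. \<forall>v\<in>U. x \<bullet> v \<le> support_fun K v}"
    show "x \<in> K"
    proof (rule ccontr)
      assume "x \<notin> K"
      then have "closed_segment 0 x \<inter> frontier K \<noteq> {}"
        using 0 interior_subset by (intro connected_Int_frontier) auto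
      then obtain y where "y \<in> closed_segment 0 x" and y: "y \<in> frontier K" by blast
      then obtain t where t: "y = t *\<^sub>R x" "0 \<le> t" "t \<le> 1" by (auto simp: in_segment)
      obtain v where v: "v \<in> U" "y \<bullet> v = support_fun K v" using sub y by (auto simp: F_def)
      \<comment> \<open>Here \<open>t < 1\<close>, so the segment reaches the supporting line at
        \<open>y\<close> strictly before \<open>x\<close>, which puts \<open>x\<close> beyond that
        line.\<close>
      have "support_fun K v > 0" using v U by (intro support_fun_pos[OF cK(1) 0]) auto
      moreover have "x \<bullet> v \<le> support_fun K v" using x v by auto
      moreover have "t * (x \<bullet> v) = support_fun K v" using v t by simp
      moreover have "t \<noteq> 1" using t y fr \<open>x \<notin> K\<close> by auto
      ultimately show False using t
        by (smt (verit, best) mult_left_mono mult_less_cancel_right2 mult_nonneg_nonpos)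
    qed
  qed (auto intro: inner_le_support_fun[OF cK(1)])
qed

section \<open>The \<open>L_p\<close> surface area measure\<close>

lemma support_fun_powr_measurable:
  assumes "compact K" "K \<noteq> {}"
  shows "(\<lambda>v. ennreal (support_fun K v powr q)) \<in> borel_measurable (surface_area_measure K)"
proof -
  have "(\<lambda>v. ennreal (support_fun K v powr q)) \<in> borel_measurable borel"
    using support_fun_measurable[OF assms] by measurable
  then have "(\<lambda>v. ennreal (support_fun K v powr q)) \<in> borel_measurable circle_borel"
    by (rule measurable_restrict_space1)
  then show ?thesis by (simp cong: measurable_cong_sets)
qed

lemma emeasure_Lp_surface_area_measure_singleton:
  assumes K: "convex_body K" and v: "norm v = 1"
  shows "emeasure (Lp_surface_area_measure p K) {v} =
    ennreal (support_fun K v powr (1 - p)) * hausdorff1 {x \<in> K. x \<bullet> v = support_fun K v}"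
proof -
  have cK: "compact K" "K \<noteq> {}" using K by (auto simp: convex_body_def)
  let ?f = "\<lambda>v. ennreal (support_fun K v powr (1 - p))"
  have sv: "{v} \<in> sets (surface_area_measure K)" using v by (auto simp: sets_restrict_space)
  have "emeasure (Lp_surface_area_measure p K) {v}
      = (\<integral>\<^sup>+ w. ?f w * indicator {v} w \<partial>surface_area_measure K)"
    unfolding Lp_surface_area_measure_def
    by (rule emeasure_density[OF support_fun_powr_measurable[OF cK] sv])
  also have "\<dots> = (\<integral>\<^sup>+ w. ?f v * indicator {v} w \<partial>surface_area_measure K)"
    by (intro nn_integral_cong) (auto simp: indicator_def)
  also have "\<dots> = ?f v * emeasure (surface_area_measure K) {v}"
    by (rule nn_integral_cmult_indicator[OF sv])
  finally show ?thesis using emeasure_surface_area_measure_singleton[OF K v] by simp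
qed

text \<open>The density is positive on the circle because the origin is an interior point.\<close>

lemma Lp_surface_area_measure_null_iff:
  assumes K: "convex_body K" and 0: "0 \<in> interior K" and \<omega>: "\<omega> \<in> sets circle_borel"
  shows "emeasure (Lp_surface_area_measure p K) \<omega> = 0 \<longleftrightarrow> emeasure (surface_area_measure K) \<omega> = 0"
proof -
  have cK: "compact K" "K \<noteq> {}" using K by (auto simp: convex_body_def)
  let ?f = "\<lambda>v. ennreal (support_fun K v powr (1 - p))"
  have meas: "?f \<in> borel_measurable (surface_area_measure K)"
    by (rule support_fun_powr_measurable[OF cK])
  have sp: "\<omega> \<subseteq> sphere 0 1" using \<omega> by (auto simp: sets_restrict_space)
  have s: "\<omega> \<in> sets (surface_area_measure K)" using \<omega> by simp
  have "emeasure (Lp_surface_area_measure p K) \<omega> = 0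
      \<longleftrightarrow> (\<integral>\<^sup>+ w. ?f w * indicator \<omega> w \<partial>surface_area_measure K) = 0"
    unfolding Lp_surface_area_measure_def using emeasure_density[OF meas s] by simp
  also have "\<dots> \<longleftrightarrow> (AE w in surface_area_measure K. ?f w * indicator \<omega> w = 0)"
    by (intro nn_integral_0_iff_AE borel_measurable_times_ennreal meas borel_measurable_indicator s)
  also have "\<dots> \<longleftrightarrow> (AE w in surface_area_measure K. w \<notin> \<omega>)"
  proof -
    have "?f w * indicator \<omega> w = 0 \<longleftrightarrow> w \<notin> \<omega>" for w
      using support_fun_pos[OF cK(1) 0, of w] sp by (cases "w = 0") (auto simp: indicator_def)
    then show ?thesis by simp
  qed
  also have "\<dots> \<longleftrightarrow> emeasure (surface_area_measure K) \<omega> = 0"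
    by (rule AE_iff_measurable[OF s]) (use sets.sets_into_space[OF s] in auto)
  finally show ?thesis .
qed

text \<open>Turns a unit atom into an equation for the length of a face. The face cannot be empty,
  since its mass would be 0; this is what orders the endpoints.\<close>

lemma Lp_surface_area_measure_segment_face:
  fixes e :: "real^2"
  assumes K: "convex_body K" and v: "norm v = 1" and e: "norm e = 1"
    and face: "{x \<in> K. x \<bullet> v = support_fun K v} = (\<lambda>r. a + r *\<^sub>R e) ` {s..t}"
    and one: "emeasure (Lp_surface_area_measure p K) {v} = 1"
  shows "s \<le> t" and "support_fun K v powr (1 - p) * (t - s) = 1"
proof -
  have *: "ennreal (support_fun K v powr (1 - p)) * hausdorff1 ((\<lambda>r. a + r *\<^sub>R e) ` {s..t}) = 1"
    using one unfolding emeasure_Lp_surface_area_measure_singleton[OF K v] face .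
  show le: "s \<le> t"
  proof (rule ccontr)
    assume "\<not> s \<le> t"
    with * show False by simp
  qed
  have "ennreal (support_fun K v powr (1 - p) * (t - s)) = 1"
    using * unfolding hausdorff1_segment[OF e le] using le by (simp add: ennreal_mult)
  then show "support_fun K v powr (1 - p) * (t - s) = 1"
    by simp
qed

text \<open>With \<open>s = a / h\<close>, \<open>t = b / h\<close> and \<open>q = t\<^sup>2 - t\<close> the equations become
  \<open>(2 + s) s\<^sup>3 = s + t = (2 - t) t\<^sup>3\<close>. The second one gives \<open>s = q - q\<^sup>2 \<le> 1/4\<close>, whence
  \<open>(2 + s) s\<^sup>3 < s\<close>.\<close>

lemma trapezoid_equations_unsolvable:
  fixes a b h :: real
  assumes pos: "a > 0" "b > 0" "h > 0"
    and 1: "a ^ 3 * (2 * h + a) = h ^ 3 * (a + b)"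
    and 2: "b ^ 3 * (2 * h - b) = h ^ 3 * (a + b)"
  shows False
proof -
  define s t where "s = a / h" and "t = b / h"
  have ab: "a = s * h" "b = t * h" and st: "s > 0" "t > 0"
    using pos by (auto simp: s_def t_def)
  have "h ^ 4 * (s ^ 3 * (2 + s)) = h ^ 4 * (s + t)" "h ^ 4 * (t ^ 3 * (2 - t)) = h ^ 4 * (s + t)"
    using 1 2 unfolding ab by (simp_all add: algebra_simps power_numeral_reduce)
  then have s: "s ^ 3 * (2 + s) = s + t" and t: "t ^ 3 * (2 - t) = s + t"
    using pos by simp_all
  have "s = 1/4 - ((t\<^sup>2 - t) - 1/2)\<^sup>2"
    using t by (simp add: algebra_simps power_numeral_reduce power2_eq_square)
  then have s14: "s \<le> 1/4" by (simp add: zero_le_power2)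
  \<comment> \<open>The right-hand side equals \<open>9/64 * s\<close>, which is below
    \<open>s + t\<close>.\<close>
  have "s ^ 3 * (2 + s) \<le> (s * (1/4)\<^sup>2) * (2 + 1/4)"
    unfolding power3_eq_cube power2_eq_square mult.assoc using s14 st
    by (intro mult_mono mult_left_mono) auto
  then show False using s st by (simp add: power2_eq_square)
qed

theorem proposition5p3:
  fixes u :: "nat \<Rightarrow> real^2"
  assumes "u 1 = vector [1, 0]"
    and "u 2 = vector [- 1 / 2, sqrt 3 / 2]"
    and "u 3 = vector [- 1, 0]"
    and "u 4 = vector [- 1 / 2, - sqrt 3 / 2]"
  shows "pos_hull {1..4} u = UNIV \<and>
    \<not> (\<exists>P. convex_body P \<and> 0 \<in> interior P \<and>
          (\<forall>\<omega>\<in>sets circle_borel.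
             emeasure (Lp_surface_area_measure (-2) P) \<omega> =
             (\<Sum>i=1..4. emeasure (return circle_borel (u i)) \<omega>)))"
proof (intro conjI notI)
  have I: "{1..4::nat} = {1, 2, 3, 4}" by auto
  have s3: "sqrt 3 > 0" "sqrt 3 * sqrt 3 = 3" by simp_all
  have uc': "u 1 $ 1 = 1" "u 1 $ 2 = 0" "u 2 $ 1 = - 1 / 2" "u 2 $ 2 = sqrt 3 / 2"
    "u 3 $ 1 = - 1" "u 3 $ 2 = 0" "u 4 $ 1 = - 1 / 2" "u 4 $ 2 = - sqrt 3 / 2"
    using assms by simp_all
  \<comment> \<open>The facts on \<open>u 1\<close> are repeated with index \<open>Suc 0\<close>,
    the form into which simplification brings the index 1.\<close>
  note uc = uc' uc'(1,2)[unfolded One_nat_def]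

  \<comment> \<open>The positive hull\<close>
  show "pos_hull {1..4} u = UNIV"
  proof -
    have "x \<in> pos_hull {1..4} u" for x
    proof -
      \<comment> \<open>The second coordinate is produced by \<open>u 2\<close> or
        \<open>u 4\<close>, depending on the sign of \<open>y\<close>. Either one adds
        \<open>- \<bar>y\<bar>\<close> to the first coordinate; \<open>r\<close> is what then
        remains for \<open>u 1\<close> or \<open>u 3\<close>.\<close>
      define y where "y = x $ 2 / sqrt 3"
      define r where "r = x $ 1 + \<bar>y\<bar>"
      define l where "l i = (if i = 1 then max r 0 else if i = 2 then max (2 * y) 0
        else if i = 3 then max (- r) 0 else max (- 2 * y) 0)" for i :: nat
      have "x $ 2 = y * sqrt 3" using s3 by (simp add: y_def)
      then have "x = (\<Sum>i\<in>{1..4}. l i *\<^sub>R u i)"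
        unfolding I vec_eq_iff forall_2 by (auto simp: l_def uc r_def max_def abs_if field_simps)
      moreover have "\<forall>i\<in>{1..4}. 0 \<le> l i" by (auto simp: l_def)
      ultimately show ?thesis unfolding pos_hull_def by blast
    qed
    then show ?thesis by blast
  qed

  \<comment> \<open>From the prescribed measure to four half-planes\<close>
  assume "\<exists>P. convex_body P \<and> 0 \<in> interior P \<and>
          (\<forall>\<omega>\<in>sets circle_borel.
             emeasure (Lp_surface_area_measure (-2) P) \<omega> =
             (\<Sum>i=1..4. emeasure (return circle_borel (u i)) \<omega>))"
  then obtain P where P: "convex_body P" "0 \<in> interior P"
    and eq: "\<And>\<omega>. \<omega> \<in> sets circle_borel \<Longrightarrow> emeasure (Lp_surface_area_measure (-2) P) \<omega> =
             (\<Sum>i=1..4. emeasure (return circle_borel (u i)) \<omega>)" by blast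
  have cP: "compact P" using P by (simp add: convex_body_def)
  let ?h = "\<lambda>i. support_fun P (u i)"
  have norm: "norm (u i) = 1" if "i \<in> {1..4}" for i
    using that unfolding I by (auto simp: norm_vec_def L2_set_def sum_2 uc power_divide)
  have distinct: "u 1 \<noteq> u 2" "u 1 \<noteq> u 3" "u 1 \<noteq> u 4" "u 2 \<noteq> u 3" "u 2 \<noteq> u 4" "u 3 \<noteq> u 4"
    by (auto simp: vec_eq_iff forall_2 uc)
  have hpos: "?h i > 0" if "i \<in> {1..4}" for i
    using norm[OF that] by (intro support_fun_pos[OF cP P(2)]) auto
  have one: "emeasure (Lp_surface_area_measure (-2) P) {u i} = 1" if "i \<in> {1..4}" for i
  proof -
    have "{u i} \<in> sets circle_borel" using norm[OF that] by (auto simp: sets_restrict_space)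
    then have "emeasure (Lp_surface_area_measure (-2) P) {u i} = (\<Sum>j=1..4. indicator {u i} (u j))"
      by (simp add: eq)
    also have "\<dots> = 1" using that distinct unfolding I by (auto simp: indicator_def)
    finally show ?thesis .
  qed
  \<comment> \<open>The prescribed measure vanishes off the four directions, hence so does
    \<open>surface_area_measure P\<close>.\<close>
  have "P = {x. \<forall>v\<in>u ` {1..4}. x \<bullet> v \<le> support_fun P v}"
  proof (rule polygon_if_surface_area_measure_finite_support[OF P])
    show "finite (u ` {1..4})" by simp
    show "u ` {1..4} \<subseteq> sphere 0 1" using norm by auto
    have s: "sphere 0 1 - u ` {1..4} \<in> sets circle_borel"
      by (simp add: sets_restrict_space_iff borel_closed finite_imp_closed sets.Diff Diff_subset)
    then have "emeasure (Lp_surface_area_measure (-2) P) (sphere 0 1 - u ` {1..4}) = 0"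
      by (simp add: eq)
    then show "emeasure (surface_area_measure P) (sphere 0 1 - u ` {1..4}) = 0"
      using Lp_surface_area_measure_null_iff[OF P s] by simp
  qed
  then have "x \<in> P \<longleftrightarrow> (\<forall>v\<in>u ` {1..4}. x \<bullet> v \<le> support_fun P v)" for x
    using eqset_imp_iff[of P "{x. \<forall>v\<in>u ` {1..4}. x \<bullet> v \<le> support_fun P v}" x]
    unfolding mem_Collect_eq by blast
  then have mem: "x \<in> P \<longleftrightarrow> x $ 1 \<le> ?h 1 \<and> sqrt 3 * x $ 2 \<le> 2 * ?h 2 + x $ 1
      \<and> - x $ 1 \<le> ?h 3 \<and> - x $ 1 \<le> sqrt 3 * x $ 2 + 2 * ?h 4" for x
    unfolding I by (simp add: inner_vec_def sum_2 uc field_simps)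
  have h: "?h 1 > 0" "?h 2 > 0" "?h 3 > 0" "?h 4 > 0" using hpos by auto
  note face = Lp_surface_area_measure_segment_face[OF P(1) norm _ _ one]
  let ?S = "sqrt 3"

  \<comment> \<open>The four sides as explicit segments\<close>
  have F3: "{x \<in> P. x \<bullet> u 3 = ?h 3} = (\<lambda>r. vector [- ?h 3, 0] + r *\<^sub>R vector [0, 1])
      ` {- (2 * ?h 4 - ?h 3) / ?S..(2 * ?h 2 - ?h 3) / ?S}" (is "?A = ?B")
  proof (intro equalityI subsetI)
    fix x assume "x \<in> ?A"
    then show "x \<in> ?B"
      using s3 by (intro image_eqI[of _ _ "x $ 2"])
        (auto simp: mem vec_eq_iff forall_2 inner_vec_def sum_2 uc field_simps)
  next
    fix x assume "x \<in> ?B"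
    then show "x \<in> ?A"
      using s3 h by (auto simp: mem inner_vec_def sum_2 uc field_simps)
  qed
  have F1: "{x \<in> P. x \<bullet> u 1 = ?h 1} = (\<lambda>r. vector [?h 1, 0] + r *\<^sub>R vector [0, 1])
      ` {- (2 * ?h 4 + ?h 1) / ?S..(2 * ?h 2 + ?h 1) / ?S}" (is "?A = ?B")
  proof (intro equalityI subsetI)
    fix x assume "x \<in> ?A"
    then show "x \<in> ?B"
      using s3 by (intro image_eqI[of _ _ "x $ 2"])
        (auto simp: mem vec_eq_iff forall_2 inner_vec_def sum_2 uc field_simps)
  next
    fix x assume "x \<in> ?B"
    then show "x \<in> ?A"
      using s3 h by (auto simp: mem inner_vec_def sum_2 uc field_simps)
  qed
  have e: "norm (vector [0, 1] :: real^2) = 1" "norm (vector [?S / 2, 1 / 2] :: real^2) = 1"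
    "norm (vector [?S / 2, - 1 / 2] :: real^2) = 1"
    by (simp_all add: norm_vec_def L2_set_def sum_2 power_divide)
  \<comment> \<open>The side normal to \<open>u 3\<close> is nonempty, so the two slanted lines have
    not crossed before reaching it. Hence each leg runs all the way between the two parallel sides,
    as \<open>F2\<close> and \<open>F4\<close> state.\<close>
  have h3: "?h 3 \<le> ?h 2 + ?h 4"
    using face(1)[OF _ e(1) F3] s3 by (simp add: divide_le_cancel)
  \<comment> \<open>The parameter is arc length measured from the point with first coordinate 0, so
    \<open>x $ 1 = r * sqrt 3 / 2\<close>; this explains the witness
    \<open>2 * x $ 1 / sqrt 3\<close>.\<close>
  have F2: "{x \<in> P. x \<bullet> u 2 = ?h 2} = (\<lambda>r. vector [0, 2 * ?h 2 / ?S] + r *\<^sub>R vector [?S / 2, 1 / 2])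
      ` {- 2 * ?h 3 / ?S..2 * ?h 1 / ?S}" (is "?A = ?B")
  proof (intro equalityI subsetI)
    fix x assume x: "x \<in> ?A"
    then have "?S * x $ 2 = 2 * ?h 2 + x $ 1" by (simp add: inner_vec_def sum_2 uc field_simps)
    then have x2: "x $ 2 = (2 * ?h 2 + x $ 1) / ?S" using s3 by (simp add: field_simps)
    have x1: "x $ 1 \<le> ?h 1" "- ?h 3 \<le> x $ 1" using x by (auto simp: mem)
    show "x \<in> ?B"
    proof (rule image_eqI)
      show "2 * x $ 1 / ?S \<in> {- 2 * ?h 3 / ?S..2 * ?h 1 / ?S}"
        unfolding atLeastAtMost_iff using x1 by (intro conjI divide_right_mono) auto
      show "x = vector [0, 2 * ?h 2 / ?S] + (2 * x $ 1 / ?S) *\<^sub>R vector [?S / 2, 1 / 2]"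
        using s3 x2 by (simp add: vec_eq_iff forall_2 add_divide_distrib diff_divide_distrib)
    qed
  next
    fix x assume "x \<in> ?B"
    then obtain r where r: "- 2 * ?h 3 / ?S \<le> r" "r \<le> 2 * ?h 1 / ?S"
      "x $ 1 = r * ?S / 2" "x $ 2 = 2 * ?h 2 / ?S + r / 2" by auto
    have "- 2 * ?h 3 \<le> r * ?S" "r * ?S \<le> 2 * ?h 1" using r(1,2) s3 by (simp_all add: field_simps)
    then have "- ?h 3 \<le> x $ 1" "x $ 1 \<le> ?h 1" using r(3) by simp_all
    moreover have "?S * x $ 2 = 2 * ?h 2 + x $ 1" unfolding r(3,4) using s3 by (simp add: field_simps)
    ultimately show "x \<in> ?A"
      using h h3 by (simp add: mem inner_vec_def sum_2 uc field_simps)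
  qed
  have F4: "{x \<in> P. x \<bullet> u 4 = ?h 4} = (\<lambda>r. vector [0, - 2 * ?h 4 / ?S] + r *\<^sub>R vector [?S / 2, - 1 / 2])
      ` {- 2 * ?h 3 / ?S..2 * ?h 1 / ?S}" (is "?A = ?B")
  proof (intro equalityI subsetI)
    fix x assume x: "x \<in> ?A"
    then have "- ?S * x $ 2 = 2 * ?h 4 + x $ 1" by (simp add: inner_vec_def sum_2 uc field_simps)
    then have x2: "x $ 2 = - (2 * ?h 4 + x $ 1) / ?S" using s3 by (simp add: field_simps)
    have x1: "x $ 1 \<le> ?h 1" "- ?h 3 \<le> x $ 1" using x by (auto simp: mem)
    show "x \<in> ?B"
    proof (rule image_eqI)
      show "2 * x $ 1 / ?S \<in> {- 2 * ?h 3 / ?S..2 * ?h 1 / ?S}"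
        unfolding atLeastAtMost_iff using x1 by (intro conjI divide_right_mono) auto
      show "x = vector [0, - 2 * ?h 4 / ?S] + (2 * x $ 1 / ?S) *\<^sub>R vector [?S / 2, - 1 / 2]"
        using s3 x2 by (simp add: vec_eq_iff forall_2 add_divide_distrib diff_divide_distrib)
    qed
  next
    fix x assume "x \<in> ?B"
    then obtain r where r: "- 2 * ?h 3 / ?S \<le> r" "r \<le> 2 * ?h 1 / ?S"
      "x $ 1 = r * ?S / 2" "x $ 2 = - 2 * ?h 4 / ?S - r / 2" by auto
    have "- 2 * ?h 3 \<le> r * ?S" "r * ?S \<le> 2 * ?h 1" using r(1,2) s3 by (simp_all add: field_simps)
    then have "- ?h 3 \<le> x $ 1" "x $ 1 \<le> ?h 1" using r(3) by simp_all
    moreover have "- ?S * x $ 2 = 2 * ?h 4 + x $ 1" unfolding r(3,4) using s3 by (simp add: field_simps)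
    ultimately show "x \<in> ?A"
      using h h3 by (simp add: mem inner_vec_def sum_2 uc field_simps)
  qed

  \<comment> \<open>The length equations and their contradiction\<close>
  \<comment> \<open>Each side has length \<open>l / sqrt 3\<close>, and for \<open>p = -2\<close>
    the exponent \<open>1 - p\<close> is 3, so unit mass reads
    \<open>c ^ 3 * l = sqrt 3\<close>.\<close>
  have L: "c ^ 3 * l = ?S" if "c powr (1 - - 2) * (t - s) = 1" "t - s = l / ?S" "c > 0" for c t s l
  proof -
    have "c powr (1 - - 2) = c ^ 3" using that(3) by simp
    then have "c ^ 3 * l / ?S = 1" using that(1) unfolding that(2) by (simp only: times_divide_eq_right)
    then show ?thesis by (simp only: divide_eq_1_iff)
  qed
  have len: "?h 1 ^ 3 * (2 * ?h 2 + 2 * ?h 4 + 2 * ?h 1) = ?S"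
    "?h 3 ^ 3 * (2 * ?h 2 + 2 * ?h 4 - 2 * ?h 3) = ?S"
    "?h 2 ^ 3 * (2 * (?h 1 + ?h 3)) = ?S" "?h 4 ^ 3 * (2 * (?h 1 + ?h 3)) = ?S"
    by (rule L[OF face(2)[OF _ e(1) F1]] L[OF face(2)[OF _ e(1) F3]]
          L[OF face(2)[OF _ e(2) F2]] L[OF face(2)[OF _ e(3) F4]];
        use h in \<open>simp add: add_divide_distrib diff_divide_distrib\<close>)+
  \<comment> \<open>Both legs have the same length, so unit mass on each forces equal cubes of the
    distances.\<close>
  then have "?h 2 ^ 3 = ?h 4 ^ 3"
    using h by (metis add_pos_pos mult_right_cancel mult_2 less_irrefl)
  then have h24: "?h 2 = ?h 4" using h by (simp add: power_eq_iff_eq_base)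
  show False
  proof (rule trapezoid_equations_unsolvable[OF h(1) h(3) h(2)])
    show "?h 1 ^ 3 * (2 * ?h 2 + ?h 1) = ?h 2 ^ 3 * (?h 1 + ?h 3)"
      using len(1,3) h24 by (simp add: algebra_simps)
    show "?h 3 ^ 3 * (2 * ?h 2 - ?h 3) = ?h 2 ^ 3 * (?h 1 + ?h 3)"
      using len(2,3) h24 by (simp add: algebra_simps)
  qed
qed

end
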